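(* Let $F:\bar{\mathcal C}\to\mathcal C$ be a full additive functor between linear categories with $\mathrm{Ker}(F)^2=0$. Let $(C^\cdot,d_C)$ and $(D^\cdot,d_D)$ be cochain complexes in $\mathcal C$ and let $f:C^\cdot\to D^\cdot$ and $g:D^\cdot\to C^\cdot$ be cochain maps which are homotopy inverse to each other. Suppose we have fixed graded lifts $\bar C^\cdot$ and $\bar D^\cdot$ of $C^\cdot$ and $D^\cdot$ along $F$. (1) Suppose $\bar d_D\in L(d_D\,|\,\bar D^\cdot)$. There exists $\bar d_C\in L(d_C\,|\,\bar C^\cdot)$ with $o(f\,|\,\bar d_C,\bar d_D)=0$. (2) Suppose $\bar d_D\in L(d_D\,|\,\bar D^\cdot)$ and $\bar d_C\in L(d_C\,|\,\bar C^\cdot)$. For every $\bar f\in L(f\,|\,\bar d_C,\bar d_D)$ there exists $\bar g\in L(g\,|\,\bar d_D,\bar d_C)$ such that $\bar f$ and $\bar g$ are homotopy inverse to each other. In particular, $\bar f$ is a homotopy equivalence.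
   Context: A linear category is a category enriched over the modules over some commutative ring. $\mathrm{Ker}(F)^2=0$ means: $gf=0$ for all composable morphisms $f,g$ of $\bar{\mathcal C}$ with $F(f)=0=F(g)$. Graded objects are families $C^\cdot=(C^i)_{i\in\mathbb Z}$; $\mathrm{Hom}^n(C^\cdot,D^\cdot)=\prod_i\mathcal C(C^i,D^{i+n})$ is the group of graded maps of degree $n$; $\delta_{d_C,d_D}(f)=d_Df-(-1)^nfd_C$ for $f\in\mathrm{Hom}^n(C^\cdot,D^\cdot)$. A graded lift of $C^\cdot$ is a graded object $\bar C^\cdot$ of $\bar{\mathcal C}$ with an isomorphism $c:C^\cdot\cong F(\bar C^\cdot)$ of graded objects. A graded lift of a graded map $f$ between graded objects with graded lifts $c,c'$ is a graded map $\bar f$ of the same degree between the lifted objects with $F(\bar f)c=c'f$. $L(d_C\,|\,\bar C^\cdot)$: graded lifts $\bar d_C$ of $d_C$ on $\bar C^\cdot$ with $\bar d_C^2=0$ (similarly for $D$). $L(f\,|\,\bar d_C,\bar d_D)$: graded lifts $\bar f$ of $f$ which are cochain maps $(\bar C^\cdot,\bar d_C)\to(\bar D^\cdot,\bar d_D)$. $o(f\,|\,\bar d_C,\bar d_D)=[\delta_{\bar d_C,\bar d_D}(\bar f)]\in H^1\mathbf C$, where $\bar f$ is any graded lift of $f$ and $\mathbf C^\cdot$ is the complex $\mathbf C^n=\{h\in\mathrm{Hom}^n(\bar C^\cdot,\bar D^\cdot):F(h)=0\}$ with differential $\delta_{\bar d_C,\bar d_D}$; it vanishes if and only if $L(f\,|\,\bar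 d_C,\bar d_D)\ne\varnothing$. *)

theory Defs
  imports "HOL-Algebra.Module" "HOL-Algebra.Coset"
begin

section \<open>Linear categories and additive functors\<close>

text \<open>
  Categories enriched over the modules over a commutative ring. The hom-objects are modules of
  the library; they are not required to be disjoint, so composition is indexed by the objects
  involved: for \<open>f : X \<rightarrow> Y\<close> and \<open>g : Y \<rightarrow> Z\<close> the composite \<open>g f\<close> is \<open>Comp K X Y Z g f\<close>.
\<close>

record ('r, 'o, 'm) lin_cat =
  Scalars :: "'r ring"
  Obj :: "'o set"
  Hom :: "'o \<Rightarrow> 'o \<Rightarrow> ('r, 'm) module"
  Comp :: "'o \<Rightarrow> 'o \<Rightarrow> 'o \<Rightarrow> 'm \<Rightarrow> 'm \<Rightarrow> 'm"
  Ident :: "'o \<Rightarrow> 'm"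

locale linear_category =
  fixes K :: "('r, 'o, 'm) lin_cat"
  assumes scalars: "cring (Scalars K)"
    and hom_module: "\<lbrakk>X \<in> Obj K; Y \<in> Obj K\<rbrakk> \<Longrightarrow> module (Scalars K) (Hom K X Y)"
    and ident_closed: "X \<in> Obj K \<Longrightarrow> Ident K X \<in> carrier (Hom K X X)"
    and comp_closed:
      "\<lbrakk>X \<in> Obj K; Y \<in> Obj K; Z \<in> Obj K;
        f \<in> carrier (Hom K X Y); g \<in> carrier (Hom K Y Z)\<rbrakk>
       \<Longrightarrow> Comp K X Y Z g f \<in> carrier (Hom K X Z)"
    and comp_ident_right:
      "\<lbrakk>X \<in> Obj K; Y \<in> Obj K; f \<in> carrier (Hom K X Y)\<rbrakk> \<Longrightarrow> Comp K X X Y f (Ident K X) = f"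
    and comp_ident_left:
      "\<lbrakk>X \<in> Obj K; Y \<in> Obj K; f \<in> carrier (Hom K X Y)\<rbrakk> \<Longrightarrow> Comp K X Y Y (Ident K Y) f = f"
    and comp_assoc:
      "\<lbrakk>W \<in> Obj K; X \<in> Obj K; Y \<in> Obj K; Z \<in> Obj K;
        f \<in> carrier (Hom K W X); g \<in> carrier (Hom K X Y); h \<in> carrier (Hom K Y Z)\<rbrakk>
       \<Longrightarrow> Comp K W Y Z h (Comp K W X Y g f) = Comp K W X Z (Comp K X Y Z h g) f"
    and comp_add_right:
      "\<lbrakk>X \<in> Obj K; Y \<in> Obj K; Z \<in> Obj K;
        f \<in> carrier (Hom K X Y); f' \<in> carrier (Hom K X Y); g \<in> carrier (Hom K Y Z)\<rbrakk>
       \<Longrightarrow> Comp K X Y Z g (f \<oplus>\<^bsub>Hom K X Y\<^esub> f')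
         = Comp K X Y Z g f \<oplus>\<^bsub>Hom K X Z\<^esub> Comp K X Y Z g f'"
    and comp_add_left:
      "\<lbrakk>X \<in> Obj K; Y \<in> Obj K; Z \<in> Obj K;
        f \<in> carrier (Hom K X Y); g \<in> carrier (Hom K Y Z); g' \<in> carrier (Hom K Y Z)\<rbrakk>
       \<Longrightarrow> Comp K X Y Z (g \<oplus>\<^bsub>Hom K Y Z\<^esub> g') f
         = Comp K X Y Z g f \<oplus>\<^bsub>Hom K X Z\<^esub> Comp K X Y Z g' f"
    and comp_smult_right:
      "\<lbrakk>X \<in> Obj K; Y \<in> Obj K; Z \<in> Obj K; a \<in> carrier (Scalars K);
        f \<in> carrier (Hom K X Y); g \<in> carrier (Hom K Y Z)\<rbrakk>
       \<Longrightarrow> Comp K X Y Z g (a \<odot>\<^bsub>Hom K X Y\<^esub> f) = a \<odot>\<^bsub>Hom K X Z\<^esub> Comp K X Y Z g f"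
    and comp_smult_left:
      "\<lbrakk>X \<in> Obj K; Y \<in> Obj K; Z \<in> Obj K; a \<in> carrier (Scalars K);
        f \<in> carrier (Hom K X Y); g \<in> carrier (Hom K Y Z)\<rbrakk>
       \<Longrightarrow> Comp K X Y Z (a \<odot>\<^bsub>Hom K Y Z\<^esub> g) f = a \<odot>\<^bsub>Hom K X Z\<^esub> Comp K X Y Z g f"

record ('o, 'm, 'p, 'n) lin_functor =
  FObj :: "'o \<Rightarrow> 'p"
  FMap :: "'o \<Rightarrow> 'o \<Rightarrow> 'm \<Rightarrow> 'n"

text \<open>
  The two categories may have different rings of scalars; an additive functor is only required
  to be additive on hom-groups.
\<close>

locale additive_functor =
  A: linear_category A + B: linear_category B
  for A :: "('r, 'o, 'm) lin_cat" and B :: "('s, 'p, 'n) lin_cat" +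
  fixes F :: "('o, 'm, 'p, 'n) lin_functor"
  assumes obj_closed: "X \<in> Obj A \<Longrightarrow> FObj F X \<in> Obj B"
    and map_additive:
      "\<lbrakk>X \<in> Obj A; Y \<in> Obj A\<rbrakk>
       \<Longrightarrow> FMap F X Y \<in> hom (add_monoid (Hom A X Y)) (add_monoid (Hom B (FObj F X) (FObj F Y)))"
    and map_ident: "X \<in> Obj A \<Longrightarrow> FMap F X X (Ident A X) = Ident B (FObj F X)"
    and map_comp:
      "\<lbrakk>X \<in> Obj A; Y \<in> Obj A; Z \<in> Obj A;
        f \<in> carrier (Hom A X Y); g \<in> carrier (Hom A Y Z)\<rbrakk>
       \<Longrightarrow> FMap F X Z (Comp A X Y Z g f)
         = Comp B (FObj F X) (FObj F Y) (FObj F Z) (FMap F Y Z g) (FMap F X Y f)"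

definition full_functor ::
  "('r, 'o, 'm) lin_cat \<Rightarrow> ('s, 'p, 'n) lin_cat \<Rightarrow> ('o, 'm, 'p, 'n) lin_functor \<Rightarrow> bool" where
  "full_functor A B F \<longleftrightarrow>
     (\<forall>X \<in> Obj A. \<forall>Y \<in> Obj A.
        FMap F X Y ` carrier (Hom A X Y) = carrier (Hom B (FObj F X) (FObj F Y)))"

definition Ker ::
  "('r, 'o, 'm) lin_cat \<Rightarrow> ('s, 'p, 'n) lin_cat \<Rightarrow> ('o, 'm, 'p, 'n) lin_functor
    \<Rightarrow> 'o \<Rightarrow> 'o \<Rightarrow> 'm set" where
  "Ker A B F X Y = {f \<in> carrier (Hom A X Y). FMap F X Y f = \<zero>\<^bsub>Hom B (FObj F X) (FObj F Y)\<^esub>}"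

definition Ker_square_zero ::
  "('r, 'o, 'm) lin_cat \<Rightarrow> ('s, 'p, 'n) lin_cat \<Rightarrow> ('o, 'm, 'p, 'n) lin_functor \<Rightarrow> bool" where
  "Ker_square_zero A B F \<longleftrightarrow>
     (\<forall>X \<in> Obj A. \<forall>Y \<in> Obj A. \<forall>Z \<in> Obj A. \<forall>f \<in> Ker A B F X Y. \<forall>g \<in> Ker A B F Y Z.
        Comp A X Y Z g f = \<zero>\<^bsub>Hom A X Z\<^esub>)"


section \<open>Graded objects and cochain complexes\<close>

text \<open>
  A graded object is a family of objects indexed by the integers. A graded map \<open>f : X \<rightarrow> Y\<close> of
  degree \<open>n\<close> is a family whose component \<open>f i\<close> is a morphism \<open>X i \<rightarrow> Y (i + n)\<close>.
\<close>

definition graded_object :: "('r, 'o, 'm) lin_cat \<Rightarrow> (int \<Rightarrow> 'o) \<Rightarrow> bool" where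
  "graded_object K X \<longleftrightarrow> (\<forall>i. X i \<in> Obj K)"

definition GHom ::
  "('r, 'o, 'm) lin_cat \<Rightarrow> int \<Rightarrow> (int \<Rightarrow> 'o) \<Rightarrow> (int \<Rightarrow> 'o) \<Rightarrow> (int \<Rightarrow> 'm) set" where
  "GHom K n X Y = {f. \<forall>i. f i \<in> carrier (Hom K (X i) (Y (i + n)))}"

definition gzero ::
  "('r, 'o, 'm) lin_cat \<Rightarrow> int \<Rightarrow> (int \<Rightarrow> 'o) \<Rightarrow> (int \<Rightarrow> 'o) \<Rightarrow> int \<Rightarrow> 'm" where
  "gzero K n X Y = (\<lambda>i. \<zero>\<^bsub>Hom K (X i) (Y (i + n))\<^esub>)"

definition gadd ::
  "('r, 'o, 'm) lin_cat \<Rightarrow> int \<Rightarrow> (int \<Rightarrow> 'o) \<Rightarrow> (int \<Rightarrow> 'o)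
    \<Rightarrow> (int \<Rightarrow> 'm) \<Rightarrow> (int \<Rightarrow> 'm) \<Rightarrow> int \<Rightarrow> 'm" where
  "gadd K n X Y f g = (\<lambda>i. f i \<oplus>\<^bsub>Hom K (X i) (Y (i + n))\<^esub> g i)"

definition gminus ::
  "('r, 'o, 'm) lin_cat \<Rightarrow> int \<Rightarrow> (int \<Rightarrow> 'o) \<Rightarrow> (int \<Rightarrow> 'o)
    \<Rightarrow> (int \<Rightarrow> 'm) \<Rightarrow> (int \<Rightarrow> 'm) \<Rightarrow> int \<Rightarrow> 'm" where
  "gminus K n X Y f g = (\<lambda>i. f i \<ominus>\<^bsub>Hom K (X i) (Y (i + n))\<^esub> g i)"

definition gident :: "('r, 'o, 'm) lin_cat \<Rightarrow> (int \<Rightarrow> 'o) \<Rightarrow> int \<Rightarrow> 'm" where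
  "gident K X = (\<lambda>i. Ident K (X i))"

text \<open>
  The composite \<open>g f\<close> of \<open>f : X \<rightarrow> Y\<close> of degree \<open>p\<close> and \<open>g : Y \<rightarrow> Z\<close> of degree \<open>q\<close>, which has
  degree \<open>p + q\<close>.
\<close>

definition gcomp ::
  "('r, 'o, 'm) lin_cat \<Rightarrow> (int \<Rightarrow> 'o) \<Rightarrow> int \<Rightarrow> (int \<Rightarrow> 'o) \<Rightarrow> int \<Rightarrow> (int \<Rightarrow> 'o)
    \<Rightarrow> (int \<Rightarrow> 'm) \<Rightarrow> (int \<Rightarrow> 'm) \<Rightarrow> int \<Rightarrow> 'm" where
  "gcomp K X p Y q Z g f =
     (\<lambda>i. Comp K (X i) (Y (i + p)) (Z (i + p + q)) (g (i + p)) (f i))"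

definition delta ::
  "('r, 'o, 'm) lin_cat \<Rightarrow> (int \<Rightarrow> 'o) \<Rightarrow> (int \<Rightarrow> 'm) \<Rightarrow> (int \<Rightarrow> 'o) \<Rightarrow> (int \<Rightarrow> 'm)
    \<Rightarrow> int \<Rightarrow> (int \<Rightarrow> 'm) \<Rightarrow> int \<Rightarrow> 'm" where
  "delta K X dX Y dY n f =
     (if even n
      then gminus K (n + 1) X Y (gcomp K X n Y 1 Y dY f) (gcomp K X 1 X n Y f dX)
      else gadd K (n + 1) X Y (gcomp K X n Y 1 Y dY f) (gcomp K X 1 X n Y f dX))"

definition cochain_complex ::
  "('r, 'o, 'm) lin_cat \<Rightarrow> (int \<Rightarrow> 'o) \<Rightarrow> (int \<Rightarrow> 'm) \<Rightarrow> bool" where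
  "cochain_complex K X d \<longleftrightarrow>
     graded_object K X \<and> d \<in> GHom K 1 X X \<and> gcomp K X 1 X 1 X d d = gzero K 2 X X"

definition cochain_map ::
  "('r, 'o, 'm) lin_cat \<Rightarrow> (int \<Rightarrow> 'o) \<Rightarrow> (int \<Rightarrow> 'm) \<Rightarrow> (int \<Rightarrow> 'o) \<Rightarrow> (int \<Rightarrow> 'm)
    \<Rightarrow> (int \<Rightarrow> 'm) \<Rightarrow> bool" where
  "cochain_map K X dX Y dY f \<longleftrightarrow>
     f \<in> GHom K 0 X Y \<and> gcomp K X 0 Y 1 Y dY f = gcomp K X 1 X 0 Y f dX"

definition homotopic ::
  "('r, 'o, 'm) lin_cat \<Rightarrow> (int \<Rightarrow> 'o) \<Rightarrow> (int \<Rightarrow> 'm) \<Rightarrow> (int \<Rightarrow> 'o) \<Rightarrow> (int \<Rightarrow> 'm)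
    \<Rightarrow> (int \<Rightarrow> 'm) \<Rightarrow> (int \<Rightarrow> 'm) \<Rightarrow> bool" where
  "homotopic K X dX Y dY f g \<longleftrightarrow>
     (\<exists>h \<in> GHom K (-1) X Y. gminus K 0 X Y f g = delta K X dX Y dY (-1) h)"

definition homotopy_inverse ::
  "('r, 'o, 'm) lin_cat \<Rightarrow> (int \<Rightarrow> 'o) \<Rightarrow> (int \<Rightarrow> 'm) \<Rightarrow> (int \<Rightarrow> 'o) \<Rightarrow> (int \<Rightarrow> 'm)
    \<Rightarrow> (int \<Rightarrow> 'm) \<Rightarrow> (int \<Rightarrow> 'm) \<Rightarrow> bool" where
  "homotopy_inverse K X dX Y dY f g \<longleftrightarrow>
     cochain_map K X dX Y dY f \<and> cochain_map K Y dY X dX g \<and>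
     homotopic K X dX X dX (gcomp K X 0 Y 0 X g f) (gident K X) \<and>
     homotopic K Y dY Y dY (gcomp K Y 0 X 0 Y f g) (gident K Y)"

definition homotopy_equivalence ::
  "('r, 'o, 'm) lin_cat \<Rightarrow> (int \<Rightarrow> 'o) \<Rightarrow> (int \<Rightarrow> 'm) \<Rightarrow> (int \<Rightarrow> 'o) \<Rightarrow> (int \<Rightarrow> 'm)
    \<Rightarrow> (int \<Rightarrow> 'm) \<Rightarrow> bool" where
  "homotopy_equivalence K X dX Y dY f \<longleftrightarrow> (\<exists>g. homotopy_inverse K X dX Y dY f g)"


section \<open>Graded lifts\<close>

definition gFObj :: "('o, 'm, 'p, 'n) lin_functor \<Rightarrow> (int \<Rightarrow> 'o) \<Rightarrow> int \<Rightarrow> 'p" where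
  "gFObj F X = (\<lambda>i. FObj F (X i))"

definition gFMap ::
  "('o, 'm, 'p, 'n) lin_functor \<Rightarrow> int \<Rightarrow> (int \<Rightarrow> 'o) \<Rightarrow> (int \<Rightarrow> 'o) \<Rightarrow> (int \<Rightarrow> 'm) \<Rightarrow> int \<Rightarrow> 'n" where
  "gFMap F n X Y f = (\<lambda>i. FMap F (X i) (Y (i + n)) (f i))"

definition graded_iso ::
  "('r, 'o, 'm) lin_cat \<Rightarrow> (int \<Rightarrow> 'o) \<Rightarrow> (int \<Rightarrow> 'o) \<Rightarrow> (int \<Rightarrow> 'm) \<Rightarrow> bool" where
  "graded_iso K X Y c \<longleftrightarrow>
     c \<in> GHom K 0 X Y \<and>
     (\<exists>c' \<in> GHom K 0 Y X.
        gcomp K X 0 Y 0 X c' c = gident K X \<and> gcomp K Y 0 X 0 Y c c' = gident K Y)"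

definition graded_lift_obj ::
  "('r, 'o, 'm) lin_cat \<Rightarrow> ('s, 'p, 'n) lin_cat \<Rightarrow> ('o, 'm, 'p, 'n) lin_functor
    \<Rightarrow> (int \<Rightarrow> 'p) \<Rightarrow> (int \<Rightarrow> 'o) \<Rightarrow> (int \<Rightarrow> 'n) \<Rightarrow> bool" where
  "graded_lift_obj A B F X Xb c \<longleftrightarrow> graded_object A Xb \<and> graded_iso B X (gFObj F Xb) c"

definition graded_lifts_map ::
  "('r, 'o, 'm) lin_cat \<Rightarrow> ('s, 'p, 'n) lin_cat \<Rightarrow> ('o, 'm, 'p, 'n) lin_functor
    \<Rightarrow> (int \<Rightarrow> 'p) \<Rightarrow> (int \<Rightarrow> 'o) \<Rightarrow> (int \<Rightarrow> 'n) \<Rightarrow> (int \<Rightarrow> 'p) \<Rightarrow> (int \<Rightarrow> 'o) \<Rightarrow> (int \<Rightarrow> 'n)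
    \<Rightarrow> int \<Rightarrow> (int \<Rightarrow> 'n) \<Rightarrow> (int \<Rightarrow> 'm) set" where
  "graded_lifts_map A B F X Xb c Y Yb c' n f =
     {fb \<in> GHom A n Xb Yb.
        gcomp B X 0 (gFObj F Xb) n (gFObj F Yb) (gFMap F n Xb Yb fb) c
        = gcomp B X n Y 0 (gFObj F Yb) c' f}"

text \<open>\<open>L(d | Xb)\<close>\<close>

definition L_diff ::
  "('r, 'o, 'm) lin_cat \<Rightarrow> ('s, 'p, 'n) lin_cat \<Rightarrow> ('o, 'm, 'p, 'n) lin_functor
    \<Rightarrow> (int \<Rightarrow> 'p) \<Rightarrow> (int \<Rightarrow> 'o) \<Rightarrow> (int \<Rightarrow> 'n) \<Rightarrow> (int \<Rightarrow> 'n) \<Rightarrow> (int \<Rightarrow> 'm) set" where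
  "L_diff A B F X Xb c d =
     {db \<in> graded_lifts_map A B F X Xb c X Xb c 1 d.
        gcomp A Xb 1 Xb 1 Xb db db = gzero A 2 Xb Xb}"

text \<open>\<open>L(f | dXb, dYb)\<close>\<close>

definition L_map ::
  "('r, 'o, 'm) lin_cat \<Rightarrow> ('s, 'p, 'n) lin_cat \<Rightarrow> ('o, 'm, 'p, 'n) lin_functor
    \<Rightarrow> (int \<Rightarrow> 'p) \<Rightarrow> (int \<Rightarrow> 'o) \<Rightarrow> (int \<Rightarrow> 'n) \<Rightarrow> (int \<Rightarrow> 'p) \<Rightarrow> (int \<Rightarrow> 'o) \<Rightarrow> (int \<Rightarrow> 'n)
    \<Rightarrow> (int \<Rightarrow> 'n) \<Rightarrow> (int \<Rightarrow> 'm) \<Rightarrow> (int \<Rightarrow> 'm) \<Rightarrow> (int \<Rightarrow> 'm) set" where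
  "L_map A B F X Xb c Y Yb c' f dXb dYb =
     {fb \<in> graded_lifts_map A B F X Xb c Y Yb c' 0 f. cochain_map A Xb dXb Yb dYb fb}"


section \<open>The obstruction class\<close>

text \<open>
  Cohomology of a complex of (multiplicatively written) groups \<open>G n\<close> with differentials
  \<open>\<delta> n : G n \<rightarrow> G (n + 1)\<close>.
\<close>

definition coboundaries :: "(int \<Rightarrow> 'a monoid) \<Rightarrow> (int \<Rightarrow> 'a \<Rightarrow> 'a) \<Rightarrow> int \<Rightarrow> 'a set" where
  "coboundaries G \<delta> n = \<delta> (n - 1) ` carrier (G (n - 1))"

definition cocycle_group :: "(int \<Rightarrow> 'a monoid) \<Rightarrow> (int \<Rightarrow> 'a \<Rightarrow> 'a) \<Rightarrow> int \<Rightarrow> 'a monoid" where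
  "cocycle_group G \<delta> n = (G n)\<lparr>carrier := kernel (G n) (G (n + 1)) (\<delta> n)\<rparr>"

definition cohomology :: "(int \<Rightarrow> 'a monoid) \<Rightarrow> (int \<Rightarrow> 'a \<Rightarrow> 'a) \<Rightarrow> int \<Rightarrow> 'a set monoid" where
  "cohomology G \<delta> n = cocycle_group G \<delta> n Mod coboundaries G \<delta> n"

definition cohomology_class ::
  "(int \<Rightarrow> 'a monoid) \<Rightarrow> (int \<Rightarrow> 'a \<Rightarrow> 'a) \<Rightarrow> int \<Rightarrow> 'a \<Rightarrow> 'a set" where
  "cohomology_class G \<delta> n x = coboundaries G \<delta> n #>\<^bsub>cocycle_group G \<delta> n\<^esub> x"

text \<open>The groups \<open>{h \<in> Hom\<^sup>n(Xb, Yb). F(h) = 0}\<close> under addition.\<close>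

definition ker_complex ::
  "('r, 'o, 'm) lin_cat \<Rightarrow> ('s, 'p, 'n) lin_cat \<Rightarrow> ('o, 'm, 'p, 'n) lin_functor
    \<Rightarrow> (int \<Rightarrow> 'o) \<Rightarrow> (int \<Rightarrow> 'o) \<Rightarrow> int \<Rightarrow> (int \<Rightarrow> 'm) monoid" where
  "ker_complex A B F Xb Yb n =
     \<lparr>carrier = {h \<in> GHom A n Xb Yb. gFMap F n Xb Yb h = gzero B n (gFObj F Xb) (gFObj F Yb)},
      mult = gadd A n Xb Yb,
      one = gzero A n Xb Yb\<rparr>"

definition obstruction_group ::
  "('r, 'o, 'm) lin_cat \<Rightarrow> ('s, 'p, 'n) lin_cat \<Rightarrow> ('o, 'm, 'p, 'n) lin_functor
    \<Rightarrow> (int \<Rightarrow> 'o) \<Rightarrow> (int \<Rightarrow> 'o) \<Rightarrow> (int \<Rightarrow> 'm) \<Rightarrow> (int \<Rightarrow> 'm) \<Rightarrow> (int \<Rightarrow> 'm) set monoid" where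
  "obstruction_group A B F Xb Yb dXb dYb =
     cohomology (ker_complex A B F Xb Yb) (delta A Xb dXb Yb dYb) 1"

text \<open>
  The class \<open>o(f | dXb, dYb)\<close>. The chosen graded lift of \<open>f\<close> exists when \<open>F\<close> is full, and the
  class does not depend on it: two graded lifts differ by a map \<open>h\<close> of degree \<open>0\<close> with
  \<open>F(h) = 0\<close>. As the group above is written multiplicatively by the library's quotient
  construction, vanishing of the class means equality with \<open>\<one>\<close>.
\<close>

definition obstruction ::
  "('r, 'o, 'm) lin_cat \<Rightarrow> ('s, 'p, 'n) lin_cat \<Rightarrow> ('o, 'm, 'p, 'n) lin_functor
    \<Rightarrow> (int \<Rightarrow> 'p) \<Rightarrow> (int \<Rightarrow> 'o) \<Rightarrow> (int \<Rightarrow> 'n) \<Rightarrow> (int \<Rightarrow> 'p) \<Rightarrow> (int \<Rightarrow> 'o) \<Rightarrow> (int \<Rightarrow> 'n)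
    \<Rightarrow> (int \<Rightarrow> 'n) \<Rightarrow> (int \<Rightarrow> 'm) \<Rightarrow> (int \<Rightarrow> 'm) \<Rightarrow> (int \<Rightarrow> 'm) set" where
  "obstruction A B F X Xb c Y Yb c' f dXb dYb =
     cohomology_class (ker_complex A B F Xb Yb) (delta A Xb dXb Yb dYb) 1
       (delta A Xb dXb Yb dYb 0 (SOME fb. fb \<in> graded_lifts_map A B F X Xb c Y Yb c' 0 f))"

end

theory Submission
  imports Defs "HOL-Library.Function_Algebras"
begin

text \<open>
  The kernel \<open>I\<close> of \<open>F\<close> is an ideal of square zero, so a product with a factor in \<open>I\<close> depends on
  the other factors modulo \<open>I\<close> only. Since \<open>F\<close> is full, the maps \<open>f\<close>, \<open>g\<close>, the differentials and
  the homotopies between the composites and the identities have lifts, and the relations between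
  the lifts hold modulo \<open>I\<close>. On the complexes of maps in \<open>I\<close> they therefore hold exactly:
  composition with a lift of \<open>f\<close> is invertible up to homotopy there, whatever lifts are chosen.

  All obstructions are cocycles with values in \<open>I\<close>. For the first claim, the square of an
  arbitrary lift of \<open>d_C\<close> becomes a coboundary after composition with \<open>f\<close>, because \<open>d_D\<close> is
  lifted to a differential; hence it is a coboundary, and the lift can be corrected to a
  differential. The obstruction to lifting \<open>f\<close> is then removed by a further change of the
  differential by a cocycle, as composition with \<open>f\<close> is onto in cohomology
  (\<open>lift_differential\<close>). For the second claim, the obstruction to lifting \<open>g\<close> vanishes by the
  same argument. The resulting lift is a homotopy inverse up to automorphisms of complexes
  \<open>1 + \<alpha>\<close> with \<open>\<alpha>\<close> in \<open>I\<close>, whose inverses \<open>1 - \<alpha>\<close> yield a left and a right homotopy inverse of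
  the given lift of \<open>f\<close>; these agree up to homotopy (\<open>lift_homotopy_inverse\<close>).

  These arguments are computations with sums and composites of graded maps. They are carried out
  in a ring in the sense of type classes, where terms are normalised automatically. Such a ring
  is obtained by letting graded maps act on families of generalised elements, a Yoneda embedding
  (\<open>act\<close>); it represents all graded maps of a linear category faithfully, additively and
  multiplicatively. The hom-groups are given by carriers, so they are first embedded into a
  single type of class \<open>ab_group_add\<close>, the product of all abelian groups on the type of
  morphisms.
\<close>

section \<open>Abelian groups with a carrier and endomorphism rings\<close>

text \<open>
  The product of all abelian groups with elements in \<open>'a\<close>. Each of these groups embeds into it
  as a factor, so it serves as one common type of class \<open>ab_group_add\<close> for hom-groups that are
  given by carrier sets. At an index that is not an abelian group the value is pinned to
  \<open>undefined\<close> to keep the product a group.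
\<close>

typedef 'a universal_group =
  "{x :: 'a monoid \<Rightarrow> 'a. \<forall>G. comm_group G \<longrightarrow> x G \<in> carrier G}
    \<inter> {x. \<forall>G. \<not> comm_group G \<longrightarrow> x G = undefined}"
  morphisms proj Abs_universal_group
proof
  show "(\<lambda>G. if comm_group G then \<one>\<^bsub>G\<^esub> else undefined)
    \<in> {x :: 'a monoid \<Rightarrow> 'a. \<forall>G. comm_group G \<longrightarrow> x G \<in> carrier G}
      \<inter> {x. \<forall>G. \<not> comm_group G \<longrightarrow> x G = undefined}"
    by (auto intro: monoid.one_closed group.is_monoid comm_group.axioms(2))
qed

setup_lifting type_definition_universal_group

lemma comm_group_facts:
  assumes "comm_group G"
  shows "x \<in> carrier G \<Longrightarrow> y \<in> carrier G \<Longrightarrow> x \<otimes>\<^bsub>G\<^esub> y \<in> carrier G"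
    and "\<one>\<^bsub>G\<^esub> \<in> carrier G"
    and "x \<in> carrier G \<Longrightarrow> inv\<^bsub>G\<^esub> x \<in> carrier G"
proof -
  interpret comm_group G by fact
  show "x \<in> carrier G \<Longrightarrow> y \<in> carrier G \<Longrightarrow> x \<otimes>\<^bsub>G\<^esub> y \<in> carrier G"
    and "\<one>\<^bsub>G\<^esub> \<in> carrier G"
    and "x \<in> carrier G \<Longrightarrow> inv\<^bsub>G\<^esub> x \<in> carrier G"
    by auto
qed

instantiation universal_group :: (type) ab_group_add
begin

lift_definition zero_universal_group :: "'a universal_group" is
  "\<lambda>G. if comm_group G then \<one>\<^bsub>G\<^esub> else undefined"
  by (simp add: comm_group_facts)

lift_definition plus_universal_group ::
    "'a universal_group \<Rightarrow> 'a universal_group \<Rightarrow> 'a universal_group" is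
  "\<lambda>x y G. if comm_group G then x G \<otimes>\<^bsub>G\<^esub> y G else undefined"
  by (simp add: comm_group_facts)

lift_definition uminus_universal_group :: "'a universal_group \<Rightarrow> 'a universal_group" is
  "\<lambda>x G. if comm_group G then inv\<^bsub>G\<^esub> (x G) else undefined"
  by (simp add: comm_group_facts)

definition "x - y = x + - y" for x y :: "'a universal_group"

instance
proof
  fix x y z :: "'a universal_group"
  show "x + y + z = x + (y + z)"
    by transfer (auto simp: fun_eq_iff intro!: monoid.m_assoc group.is_monoid comm_group.axioms(2))
  show "x + y = y + x"
    by transfer (auto simp: fun_eq_iff intro!: comm_monoid.m_comm comm_group.axioms(1))
  show "0 + x = x"
    by transfer (auto simp: fun_eq_iff intro!: monoid.l_one group.is_monoid comm_group.axioms(2))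
  show "- x + x = 0"
    by transfer (auto simp: fun_eq_iff intro!: group.l_inv comm_group.axioms(2))
  show "x - y = x + - y"
    by (rule minus_universal_group_def)
qed

end

lift_definition embed :: "'a monoid \<Rightarrow> 'a \<Rightarrow> 'a universal_group" is
  "\<lambda>G a H. if comm_group H then if H = G \<and> a \<in> carrier G then a else \<one>\<^bsub>H\<^esub> else undefined"
  by (simp add: comm_group_facts)

lemma proj_closed: "comm_group G \<Longrightarrow> proj x G \<in> carrier G"
  by transfer simp

lemma proj_add: "comm_group G \<Longrightarrow> proj (x + y) G = proj x G \<otimes>\<^bsub>G\<^esub> proj y G"
  by transfer simp

lemma proj_embed: "comm_group G \<Longrightarrow> a \<in> carrier G \<Longrightarrow> proj (embed G a) G = a"
  by transfer simp

lemma embed_mult: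
  assumes "comm_group G" "a \<in> carrier G" "b \<in> carrier G"
  shows "embed G (a \<otimes>\<^bsub>G\<^esub> b) = embed G a + embed G b"
  using assms
  by transfer (auto simp: fun_eq_iff comm_group_facts intro!: monoid.l_one[symmetric] group.is_monoid comm_group.axioms(2))

text \<open>
  The endomorphism ring of an abelian group. It carries the class \<open>ring\<close> only, without a unit:
  the identity morphisms of a category will be represented by idempotents of such a ring.
\<close>

typedef (overloaded) 'a endo =
  "{\<phi> :: 'a::ab_group_add \<Rightarrow> 'a. \<forall>x y. \<phi> (x + y) = \<phi> x + \<phi> y}"
  morphisms app Abs_endo
  by (rule exI[of _ "\<lambda>x. x"]) simp

setup_lifting type_definition_endo

lemma endo_eqI: "(\<And>x. app \<phi> x = app \<psi> x) \<Longrightarrow> \<phi> = \<psi>"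
  by transfer auto

instantiation endo :: (ab_group_add) ring
begin

lift_definition zero_endo :: "'a endo" is "\<lambda>x. 0" by simp
lift_definition plus_endo :: "'a endo \<Rightarrow> 'a endo \<Rightarrow> 'a endo" is "\<lambda>\<phi> \<psi> x. \<phi> x + \<psi> x"
  by (simp add: algebra_simps)
lift_definition minus_endo :: "'a endo \<Rightarrow> 'a endo \<Rightarrow> 'a endo" is "\<lambda>\<phi> \<psi> x. \<phi> x - \<psi> x"
  by (simp add: algebra_simps)
lift_definition uminus_endo :: "'a endo \<Rightarrow> 'a endo" is "\<lambda>\<phi> x. - \<phi> x"
  by simp
lift_definition times_endo :: "'a endo \<Rightarrow> 'a endo \<Rightarrow> 'a endo" is "\<lambda>\<phi> \<psi> x. \<phi> (\<psi> x)"
  by simp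

instance
  by standard (transfer; auto simp: fun_eq_iff algebra_simps)+

end


section \<open>Homotopy equivalences modulo an ideal of square zero\<close>

text \<open>
  The calculus of graded maps and of the ideal \<open>I\<close> of those killed by a functor, with all maps
  represented in a single ring: \<open>H n X Y\<close> stands for the maps of degree \<open>n\<close> from \<open>X\<close> to \<open>Y\<close>, and
  \<open>e X\<close> for the identity of \<open>X\<close>. The ring remembers neither degrees nor objects; these are
  recorded by the sets \<open>H\<close> and \<open>I\<close> alone.
\<close>

locale graded_square_zero =
  fixes H :: "int \<Rightarrow> 'x \<Rightarrow> 'x \<Rightarrow> 'a::ring set"
    and I :: "int \<Rightarrow> 'x \<Rightarrow> 'x \<Rightarrow> 'a set"
    and e :: "'x \<Rightarrow> 'a"
  assumes H_add: "a \<in> H n X Y \<Longrightarrow> b \<in> H n X Y \<Longrightarrow> a + b \<in> H n X Y"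
    and H_uminus: "a \<in> H n X Y \<Longrightarrow> - a \<in> H n X Y"
    and H_mult: "\<lbrakk>a \<in> H p X Y; b \<in> H q Y Z; n = p + q\<rbrakk> \<Longrightarrow> b * a \<in> H n X Z"
    and e_left: "a \<in> H n X Y \<Longrightarrow> e Y * a = a"
    and e_right: "a \<in> H n X Y \<Longrightarrow> a * e X = a"
    and I_H: "a \<in> I n X Y \<Longrightarrow> a \<in> H n X Y"
    and I_add: "a \<in> I n X Y \<Longrightarrow> b \<in> I n X Y \<Longrightarrow> a + b \<in> I n X Y"
    and I_uminus: "a \<in> I n X Y \<Longrightarrow> - a \<in> I n X Y"
    and I_left: "\<lbrakk>a \<in> I p X Y; b \<in> H q Y Z; n = p + q\<rbrakk> \<Longrightarrow> b * a \<in> I n X Z"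
    and I_right: "\<lbrakk>a \<in> H p X Y; b \<in> I q Y Z; n = p + q\<rbrakk> \<Longrightarrow> b * a \<in> I n X Z"
    and I_square: "\<lbrakk>a \<in> I p X Y; b \<in> I q Y Z\<rbrakk> \<Longrightarrow> b * a = 0"
begin

lemma H_diff: "a \<in> H n X Y \<Longrightarrow> b \<in> H n X Y \<Longrightarrow> a - b \<in> H n X Y"
  using H_add[of a n X Y "- b"] H_uminus[of b n X Y] by simp

lemma I_diff: "a \<in> I n X Y \<Longrightarrow> b \<in> I n X Y \<Longrightarrow> a - b \<in> I n X Y"
  using I_add[of a n X Y "- b"] I_uminus[of b n X Y] by simp

text \<open>
  Because \<open>I\<close> has square zero it is a bimodule over the quotient by \<open>I\<close>. All relations that hold
  modulo \<open>I\<close> may therefore be used as exact ones when they are applied to an element of \<open>I\<close>.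
\<close>

lemma I_absorb_left:
  "\<lbrakk>a - a' \<in> I q Y Z; z \<in> I p X Y\<rbrakk> \<Longrightarrow> a * z = a' * z"
  using I_square[of z p X Y "a - a'" q Z] by (simp add: algebra_simps)

text \<open>
  In the homotopy category a left inverse \<open>l\<close> and a right inverse \<open>r\<close> of \<open>f\<close> agree, as
  \<open>r = l f r = l\<close>. Keeping track of the homotopies \<open>a\<close> and \<open>b\<close> in this chain shows that \<open>r\<close> is a
  left inverse too.
\<close>

lemma left_right_homotopy_inverse:
  assumes f: "f \<in> H 0 X Y" and l: "l \<in> H 0 Y X" and r: "r \<in> H 0 Y X"
    and a: "a \<in> H (- 1) X X" and b: "b \<in> H (- 1) Y Y"
    and f_chain: "d' * f = f * d" and l_chain: "d * l = l * d'" and r_chain: "d * r = r * d'"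
    and lf: "l * f = e X + (d * a + a * d)" and fr: "f * r = e Y + (d' * b + b * d')"
  obtains a' where "a' \<in> H (- 1) X X" "r * f - e X = d * a' + a' * d"
proof -
  note [simp] = mult.assoc
  \<comment> \<open>\<open>r f\<close> differs from \<open>(l f) (r f) = l (f r) f\<close> by the boundary of \<open>a (r f)\<close>; the latter differs from
    \<open>l f\<close> by that of \<open>l b f\<close>, and \<open>l f\<close> from the identity by that of \<open>a\<close>.\<close>
  define a' where "a' = a + l * (b * f) - a * (r * f)"
  have rf: "r * f \<in> H 0 X X" by (rule H_mult[OF f r]) simp
  have "l * (b * f) \<in> H (- 1) X X" "a * (r * f) \<in> H (- 1) X X"
    by (rule H_mult[OF H_mult[OF f b] l]; simp) (rule H_mult[OF rf a]; simp)
  then have a': "a' \<in> H (- 1) X X"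
    unfolding a'_def by (intro H_diff H_add a)
  have "l * f * (r * f) = r * f + d * (a * (r * f)) + a * (d * (r * f))"
    unfolding lf by (simp add: e_left[OF rf] algebra_simps)
  moreover have "l * f * (r * f) = l * (f * r) * f" by simp
  moreover have "\<dots> = l * f + l * (d' * (b * f)) + l * (b * (d' * f))"
    unfolding fr by (simp add: e_left[OF f] algebra_simps)
  moreover have "d * (r * f) = r * (f * d)" "l * (d' * (b * f)) = d * (l * (b * f))"
    by (metis mult.assoc r_chain f_chain) (metis mult.assoc l_chain)
  ultimately have "r * f - e X = d * a' + a' * d"
    by (simp add: a'_def lf f_chain algebra_simps)
  then show thesis using that a' by blast
qed

end

text \<open>
  A homotopy equivalence modulo \<open>I\<close>: the maps chosen in \<open>H\<close> are arbitrary lifts, so the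
  relations between them hold up to elements of \<open>I\<close> only.
\<close>

locale equivalence_mod_ideal = graded_square_zero +
  fixes X Y d d' f g h k
  assumes d: "d \<in> H 1 X X" and d': "d' \<in> H 1 Y Y"
    and f: "f \<in> H 0 X Y" and g: "g \<in> H 0 Y X"
    and h: "h \<in> H (- 1) X X" and k: "k \<in> H (- 1) Y Y"
    and f_chain: "d' * f - f * d \<in> I 1 X Y"
    and g_chain: "d * g - g * d' \<in> I 1 Y X"
    and gf: "g * f - (e X + (d * h + h * d)) \<in> I 0 X X"
    and fg: "f * g - (e Y + (d' * k + k * d')) \<in> I 0 Y Y"
begin

lemma mult_gf:
  assumes "z \<in> I n W X" shows "g * (f * z) = z + d * (h * z) + h * (d * z)"
  using I_absorb_left[OF gf assms] e_left[OF I_H[OF assms]] by (simp add: algebra_simps)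

lemma mult_fg:
  assumes "z \<in> I n W Y" shows "f * (g * z) = z + d' * (k * z) + k * (d' * z)"
  using I_absorb_left[OF fg assms] e_left[OF I_H[OF assms]] by (simp add: algebra_simps)

lemma mult_g_chain: "z \<in> I n W Y \<Longrightarrow> d * (g * z) = g * (d' * z)"
  using I_absorb_left[OF g_chain]
  by (simp add: mult.assoc)

text \<open>
  Two obstructions are removed one after the other. The first is the class of \<open>w = d d\<close>.
  Composition with \<open>f\<close> turns it into minus the boundary of the defect \<open>\<phi> = d' f - f d\<close>, because
  \<open>d' d' = 0\<close>; as \<open>f\<close> is invertible up to homotopy on \<open>I\<close>, \<open>w\<close> itself is a boundary, and \<open>d\<close> can
  be corrected to a differential \<open>d1\<close>. The second is the class of the new defect
  \<open>\<psi> = d' f - f d1\<close>. A differential may be changed further by any cocycle of \<open>I\<close>, and since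
  composition with \<open>f\<close> is onto in cohomology, the cocycle \<open>g \<psi>\<close> changes the defect by \<open>\<psi>\<close> up to
  a boundary, which a correction of \<open>f\<close> absorbs.
\<close>

lemma lift_differential:
  assumes d'_square: "d' * d' = 0" and d_square: "d * d \<in> I 2 X X"
  obtains d2 f2 where "d2 \<in> H 1 X X" "f2 \<in> H 0 X Y" "d2 - d \<in> I 1 X X" "f2 - f \<in> I 0 X Y"
    "d2 * d2 = 0" "d' * f2 = f2 * d2"
proof -
  note [simp] = mult.assoc
  define w where "w = d * d"
  define \<phi> where "\<phi> = d' * f - f * d"
  have w: "w \<in> I 2 X X" and phi: "\<phi> \<in> I 1 X Y"
    using d_square f_chain by (simp_all add: w_def \<phi>_def)
  \<comment> \<open>Read off from \<open>w = g f w - d h w - h d w\<close> when \<open>f w\<close> is replaced by minus the boundary of \<open>\<phi>\<close>: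
    \<open>w\<close> is then minus the boundary of \<open>\<eta>\<close>.\<close>
  define \<eta> where "\<eta> = g * \<phi> + h * w"
  have eta: "\<eta> \<in> I 1 X X"
    unfolding \<eta>_def by (rule I_add[OF I_left[OF phi g] I_left[OF w h]]) simp_all
  have "d' * (d' * f) = 0"
    using d'_square by (simp flip: mult.assoc)
  then have fw: "f * w = - (d' * \<phi> + \<phi> * d)"
    by (simp add: w_def \<phi>_def algebra_simps)
  have "d * w = w * d" by (simp add: w_def)
  have "- (d * \<eta> + \<eta> * d) = - (d * (g * \<phi>)) - g * \<phi> * d - d * (h * w) - h * (d * w)"
    using \<open>d * w = w * d\<close> by (simp add: \<eta>_def algebra_simps)
  also have "\<dots> = g * (f * w) - d * (h * w) - h * (d * w)"
    by (simp add: mult_g_chain[OF phi] fw algebra_simps)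
  also have "\<dots> = w"
    by (simp add: mult_gf[OF w])
  finally have w_eq: "d * \<eta> + \<eta> * d = - w" by (metis minus_minus)
  define d1 where "d1 = d + \<eta>"
  have d1: "d1 \<in> H 1 X X" unfolding d1_def by (rule H_add[OF d I_H[OF eta]])
  have "\<eta> * \<eta> = 0" using I_square eta by blast
  moreover have "d1 * d1 = w + (d * \<eta> + \<eta> * d) + \<eta> * \<eta>"
    by (simp add: d1_def w_def algebra_simps)
  ultimately have d1_square: "d1 * d1 = 0" using w_eq by simp
  define \<psi> where "\<psi> = d' * f - f * d1"
  have psi: "\<psi> \<in> I 1 X Y"
    using phi eta f I_diff[of \<phi> 1 X Y "f * \<eta>"] I_left[of \<eta> 1 X X f 0 Y 1]
    by (simp add: \<psi>_def \<phi>_def d1_def algebra_simps)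
  have "d' * \<psi> + \<psi> * d1 = d' * (d' * f) - f * (d1 * d1)"
    by (simp add: \<psi>_def algebra_simps)
  then have psi_cocycle: "d' * \<psi> = - (\<psi> * d1)"
    using \<open>d' * (d' * f) = 0\<close> d1_square by (simp add: eq_neg_iff_add_eq_0)
  define \<theta> where "\<theta> = g * \<psi>"
  have theta: "\<theta> \<in> I 1 X X" unfolding \<theta>_def by (rule I_left[OF psi g]) simp
  have d1_d: "d1 - d \<in> I 1 X X" using eta by (simp add: d1_def)
  define d2 where "d2 = d1 + \<theta>"
  have d2_d: "d2 - d \<in> I 1 X X"
    using I_add[OF d1_d theta] by (simp add: d2_def algebra_simps)
  have "d1 * \<theta> = - (\<theta> * d1)"
    using mult_g_chain[OF psi] psi_cocycle I_absorb_left[OF d1_d theta] by (simp add: \<theta>_def)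
  moreover have "\<theta> * \<theta> = 0" using I_square theta by blast
  ultimately have d2_square: "d2 * d2 = 0"
    using d1_square by (simp add: d2_def algebra_simps)
  \<comment> \<open>The homotopy from \<open>f g\<close> to the identity, applied to \<open>\<psi>\<close>, exhibits \<open>f \<theta> - \<psi>\<close> as the boundary of
    \<open>k \<psi>\<close>. This is the correction of \<open>f\<close>.\<close>
  have kpsi: "k * \<psi> \<in> I 0 X Y" by (rule I_left[OF psi k]) simp
  have "f * \<theta> = \<psi> + d' * (k * \<psi>) + k * (d' * \<psi>)"
    by (simp add: \<theta>_def mult_fg[OF psi])
  also have "\<dots> = \<psi> + d' * (k * \<psi>) - k * \<psi> * d2"
    using I_square[OF theta kpsi] by (simp add: psi_cocycle d2_def algebra_simps)
  finally have chain: "d' * (f + k * \<psi>) = (f + k * \<psi>) * d2"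
    by (simp add: \<psi>_def d2_def algebra_simps)
  show thesis
  proof (rule that[of d2 "f + k * \<psi>"])
    show "d2 \<in> H 1 X X" unfolding d2_def by (rule H_add[OF d1 I_H[OF theta]])
    show "f + k * \<psi> \<in> H 0 X Y" by (rule H_add[OF f I_H[OF kpsi]])
  qed (use d2_d d2_square kpsi chain in simp_all)
qed

text \<open>
  It is enough to correct \<open>g\<close> to an exact cochain map \<open>g1\<close>. Then \<open>g1 f\<close> and \<open>f g1\<close> are homotopic
  to \<open>1 + \<alpha>\<close> and \<open>1 + \<beta>1\<close> with cocycles \<open>\<alpha>\<close>, \<open>\<beta>1\<close> of \<open>I\<close>. Those are automorphisms of complexes,
  with inverses \<open>1 - \<alpha>\<close> and \<open>1 - \<beta>1\<close>, so \<open>f\<close> has a left and a right homotopy inverse, and the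
  two agree. The obstruction \<open>\<gamma>\<close> to the correction of \<open>g\<close> is a boundary because \<open>f \<gamma>\<close> is one:
  \<open>f\<close> is an exact cochain map, so \<open>f \<gamma>\<close> is the boundary of \<open>f g\<close>, which differs by a cocycle
  from the element \<open>\<beta>\<close> of \<open>I\<close>.
\<close>

lemma lift_homotopy_inverse:
  assumes square: "d * d = 0" and square': "d' * d' = 0" and chain: "d' * f = f * d"
  obtains g' a b where "g' \<in> H 0 Y X" "a \<in> H (- 1) X X" "b \<in> H (- 1) Y Y" "g' - g \<in> I 0 Y X"
    "d * g' = g' * d'" "g' * f - e X = d * a + a * d" "f * g' - e Y = d' * b + b * d'"
proof -
  note [simp] = mult.assoc
  define \<gamma> where "\<gamma> = d * g - g * d'"
  define \<beta> where "\<beta> = f * g - (e Y + (d' * k + k * d'))"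
  have gamma: "\<gamma> \<in> I 1 Y X" and beta: "\<beta> \<in> I 0 Y Y"
    using g_chain fg by (simp_all add: \<gamma>_def \<beta>_def)
  have zero: "d * (d * z) = 0" "d' * (d' * z) = 0" for z
    using square square' by (simp_all flip: mult.assoc)
  have chain': "d' * (f * z) = f * (d * z)" for z
    using chain by (simp flip: mult.assoc)
  have f_gamma: "f * \<gamma> = d' * \<beta> - \<beta> * d'"
    by (simp add: \<gamma>_def \<beta>_def zero square' chain' e_left[OF d'] e_right[OF d'] algebra_simps)
  have d_gamma: "d * \<gamma> = - (\<gamma> * d')"
    by (simp add: \<gamma>_def zero square' algebra_simps)
  have gamma_eq: "\<gamma> = g * (d' * \<beta>) - g * \<beta> * d' - d * (h * \<gamma>) + h * \<gamma> * d'"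
    using mult_gf[OF gamma] unfolding f_gamma d_gamma by (simp add: algebra_simps)
  define g1 where "g1 = g - g * \<beta> + h * \<gamma>"
  have g_beta: "g * \<beta> \<in> I 0 Y X" by (rule I_left[OF beta g]) simp
  have h_gamma: "h * \<gamma> \<in> I 0 Y X" by (rule I_left[OF gamma h]) simp
  have g1_g: "g1 - g \<in> I 0 Y X"
    using I_diff[OF h_gamma g_beta] by (simp add: g1_def)
  have g1: "g1 \<in> H 0 Y X"
    using H_add[OF g I_H[OF g1_g]] by simp
  have "d * g1 - g1 * d' = \<gamma> - (d * (g * \<beta>) - g * \<beta> * d' - d * (h * \<gamma>) + h * \<gamma> * d')"
    by (simp add: g1_def \<gamma>_def algebra_simps)
  then have g1_chain: "d * g1 = g1 * d'"
    using gamma_eq by (simp add: mult_g_chain[OF beta])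
  have g1_chain': "d * (g1 * z) = g1 * (d' * z)" for z
    using g1_chain by (simp flip: mult.assoc)

  define \<alpha> where "\<alpha> = g1 * f - (e X + (d * h + h * d))"
  define \<beta>1 where "\<beta>1 = f * g1 - (e Y + (d' * k + k * d'))"
  have "\<alpha> = (g * f - (e X + (d * h + h * d))) + (g1 - g) * f"
    by (simp add: \<alpha>_def algebra_simps)
  then have alpha: "\<alpha> \<in> I 0 X X"
    using I_add[OF gf I_right[OF f g1_g]] by simp
  have "\<beta>1 = \<beta> + f * (g1 - g)"
    by (simp add: \<beta>_def \<beta>1_def algebra_simps)
  then have beta1: "\<beta>1 \<in> I 0 Y Y"
    using I_add[OF beta I_left[OF g1_g f]] by simp
  have alpha_chain: "d * \<alpha> = \<alpha> * d"
    by (simp add: \<alpha>_def zero square g1_chain' chain' chain e_left[OF d] e_right[OF d] algebra_simps)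
  have alpha_chain': "d * (\<alpha> * z) = \<alpha> * (d * z)" for z
    using alpha_chain by (simp flip: mult.assoc)
  have beta1_chain: "d' * \<beta>1 = \<beta>1 * d'"
    by (simp add: \<beta>1_def zero square' chain' g1_chain e_left[OF d'] e_right[OF d'] algebra_simps)

  define l where "l = g1 - \<alpha> * g1"
  define r where "r = g1 - g1 * \<beta>1"
  define a where "a = h - \<alpha> * h"
  define b where "b = k - k * \<beta>1"
  have l: "l \<in> H 0 Y X" and r: "r \<in> H 0 Y X"
    unfolding l_def r_def
    using H_diff[OF g1 I_H[OF I_right[OF g1 alpha]]] H_diff[OF g1 I_H[OF I_left[OF beta1 g1]]]
    by simp_all
  have a: "a \<in> H (- 1) X X" and b: "b \<in> H (- 1) Y Y"
    unfolding a_def b_def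
    using H_diff[OF h I_H[OF I_right[OF h alpha]]] H_diff[OF k I_H[OF I_left[OF beta1 k]]]
    by simp_all
  have "\<alpha> * \<alpha> = 0" "\<beta>1 * \<beta>1 = 0" using I_square alpha beta1 by blast+
  have gf1: "g1 * f = e X + (d * h + h * d) + \<alpha>" by (simp add: \<alpha>_def)
  have fg1: "f * g1 = e Y + (d' * k + k * d') + \<beta>1" by (simp add: \<beta>1_def)
  have "l * f = g1 * f - \<alpha> * (g1 * f)" by (simp add: l_def algebra_simps)
  also have "\<dots> = e X + (d * a + a * d)"
  proof -
    show ?thesis
      unfolding gf1 using \<open>\<alpha> * \<alpha> = 0\<close>
      by (simp add: a_def alpha_chain' e_right[OF I_H[OF alpha]] algebra_simps)
  qed
  finally have lf: "l * f = e X + (d * a + a * d)" .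
  have "f * r = f * g1 - f * g1 * \<beta>1" by (simp add: r_def algebra_simps)
  also have "\<dots> = e Y + (d' * b + b * d')"
    unfolding fg1 using \<open>\<beta>1 * \<beta>1 = 0\<close>
    by (simp add: b_def beta1_chain e_left[OF I_H[OF beta1]] algebra_simps)
  finally have fr: "f * r = e Y + (d' * b + b * d')" .
  have l_chain: "d * l = l * d'"
    by (simp add: l_def g1_chain' g1_chain alpha_chain' algebra_simps)
  have r_chain: "d * r = r * d'"
    by (simp add: r_def g1_chain' g1_chain beta1_chain algebra_simps)
  obtain a' where "a' \<in> H (- 1) X X" "r * f - e X = d * a' + a' * d"
    using left_right_homotopy_inverse[OF f l r a b chain l_chain r_chain lf fr] .
  moreover have "r - g \<in> I 0 Y X"
    using I_diff[OF g1_g I_left[OF beta1 g1]] by (simp add: r_def algebra_simps)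
  ultimately show thesis using that r b r_chain fr by simp
qed

end


section \<open>Graded maps as endomorphisms of generalised elements\<close>

text \<open>
  The hom-group as a record without the scalar multiplication, as required of an index of the
  universal group.
\<close>

definition hom_group :: "('r, 'o, 'm) lin_cat \<Rightarrow> 'o \<Rightarrow> 'o \<Rightarrow> 'm monoid" where
  "hom_group K X Y =
     \<lparr>carrier = carrier (Hom K X Y), mult = add (Hom K X Y), one = zero (Hom K X Y)\<rparr>"

lemma hom_group_simps [simp]:
  "carrier (hom_group K X Y) = carrier (Hom K X Y)"
  "mult (hom_group K X Y) = add (Hom K X Y)"
  "one (hom_group K X Y) = zero (Hom K X Y)"
  by (simp_all add: hom_group_def)

text \<open>
  The Yoneda embedding for graded maps: a graded map from \<open>X\<close> to \<open>Y\<close> acts by composition on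
  families of generalised elements, which consist of a morphism \<open>W \<rightarrow> Z j\<close> for each object \<open>W\<close>,
  graded object \<open>Z\<close> and degree \<open>j\<close>. It sends the components at \<open>X\<close> to components at \<open>Y\<close>, shifted
  by its degree, and all other components to zero. One group of families thus carries the maps
  between all graded objects, and composition of maps becomes multiplication in one ring.
\<close>

definition action ::
  "('r, 'o, 'm) lin_cat \<Rightarrow> int \<Rightarrow> (int \<Rightarrow> 'o) \<Rightarrow> (int \<Rightarrow> 'o) \<Rightarrow> (int \<Rightarrow> 'm)
    \<Rightarrow> ('o \<Rightarrow> (int \<Rightarrow> 'o) \<Rightarrow> int \<Rightarrow> 'm universal_group)
    \<Rightarrow> 'o \<Rightarrow> (int \<Rightarrow> 'o) \<Rightarrow> int \<Rightarrow> 'm universal_group" where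
  "action K n X Y f m = (\<lambda>W Z j.
     if W \<in> Obj K \<and> Z = Y
     then embed (hom_group K W (Y j))
       (Comp K W (X (j - n)) (Y j) (f (j - n))
         (proj (m W X (j - n)) (hom_group K W (X (j - n)))))
     else 0)"

definition act ::
  "('r, 'o, 'm) lin_cat \<Rightarrow> int \<Rightarrow> (int \<Rightarrow> 'o) \<Rightarrow> (int \<Rightarrow> 'o) \<Rightarrow> (int \<Rightarrow> 'm)
    \<Rightarrow> ('o \<Rightarrow> (int \<Rightarrow> 'o) \<Rightarrow> int \<Rightarrow> 'm universal_group) endo" where
  "act K n X Y f = Abs_endo (action K n X Y f)"

lemma GHomD: "f \<in> GHom K n X Y \<Longrightarrow> j = i + n \<Longrightarrow> f i \<in> carrier (Hom K (X i) (Y j))"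
  by (simp add: GHom_def)

lemma GHom_shift: "f \<in> GHom K n X Y \<Longrightarrow> f (j - n) \<in> carrier (Hom K (X (j - n)) (Y j))"
  using GHomD[of f K n X Y j "j - n"] by simp

lemma graded_objectD: "graded_object K X \<Longrightarrow> X i \<in> Obj K"
  by (simp add: graded_object_def)

context linear_category
begin

lemma hom_abelian_group: "X \<in> Obj K \<Longrightarrow> Y \<in> Obj K \<Longrightarrow> abelian_group (Hom K X Y)"
  using hom_module by (simp add: module_def)

lemma hom_comm_group:
  assumes "X \<in> Obj K" "Y \<in> Obj K" shows "comm_group (hom_group K X Y)"
proof -
  interpret abelian_group "Hom K X Y" using hom_abelian_group assms .
  show ?thesis
    by (rule comm_groupI) (auto simp: a_assoc intro: a_comm l_neg)
qed

lemmas hom_simps =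
  abelian_groupE(1)[OF hom_abelian_group] abelian_groupE(2)[OF hom_abelian_group]
  abelian_group.a_inv_closed[OF hom_abelian_group] abelian_group.minus_closed[OF hom_abelian_group]

lemma gzero_closed: "graded_object K X \<Longrightarrow> graded_object K Y \<Longrightarrow> gzero K n X Y \<in> GHom K n X Y"
  by (simp add: GHom_def gzero_def graded_objectD hom_simps)

lemma gadd_closed:
  "\<lbrakk>graded_object K X; graded_object K Y; f \<in> GHom K n X Y; g \<in> GHom K n X Y\<rbrakk>
    \<Longrightarrow> gadd K n X Y f g \<in> GHom K n X Y"
  by (simp add: GHom_def gadd_def graded_objectD hom_simps)

lemma gminus_closed:
  "\<lbrakk>graded_object K X; graded_object K Y; f \<in> GHom K n X Y; g \<in> GHom K n X Y\<rbrakk>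
    \<Longrightarrow> gminus K n X Y f g \<in> GHom K n X Y"
  by (simp add: GHom_def gminus_def graded_objectD hom_simps)

lemma gident_closed: "graded_object K X \<Longrightarrow> gident K X \<in> GHom K 0 X X"
  by (simp add: GHom_def gident_def graded_objectD ident_closed)

lemma gcomp_closed:
  "\<lbrakk>graded_object K X; graded_object K Y; graded_object K Z;
    f \<in> GHom K p X Y; g \<in> GHom K q Y Z; n = p + q\<rbrakk>
    \<Longrightarrow> gcomp K X p Y q Z g f \<in> GHom K n X Z"
  by (auto simp: GHom_def gcomp_def graded_objectD add.assoc[symmetric] intro!: comp_closed)

lemma action_add:
  assumes "graded_object K X" "graded_object K Y" "f \<in> GHom K n X Y"
  shows "action K n X Y f (m + m') = action K n X Y f m + action K n X Y f m'"
proof -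
  have "Comp K W (X (j - n)) (Y j) (f (j - n)) (a \<oplus>\<^bsub>Hom K W (X (j - n))\<^esub> b)
    = Comp K W (X (j - n)) (Y j) (f (j - n)) a
      \<oplus>\<^bsub>Hom K W (Y j)\<^esub> Comp K W (X (j - n)) (Y j) (f (j - n)) b"
    and "Comp K W (X (j - n)) (Y j) (f (j - n)) a \<in> carrier (Hom K W (Y j))"
    if "W \<in> Obj K" "a \<in> carrier (Hom K W (X (j - n)))" "b \<in> carrier (Hom K W (X (j - n)))"
    for W j a b
    using that graded_objectD[OF assms(1)] graded_objectD[OF assms(2)] GHom_shift[OF assms(3)]
    by (auto intro!: comp_add_right comp_closed)
  note linear = this
  show ?thesis
  proof (intro ext)
    fix W Z j
    show "action K n X Y f (m + m') W Z j = (action K n X Y f m + action K n X Y f m') W Z j"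
    proof (cases "W \<in> Obj K \<and> Z = Y")
      case True
      then have W: "W \<in> Obj K" and Z: "Z = Y" by auto
      note G = hom_comm_group[OF W graded_objectD[OF assms(1)]]
        hom_comm_group[OF W graded_objectD[OF assms(2)]]
      note a = proj_closed[OF G(1), of "m W X (j - n)" "j - n", simplified]
        proj_closed[OF G(1), of "m' W X (j - n)" "j - n", simplified]
      show ?thesis
        using W Z linear[OF W a] linear(2)[OF W a(2,1)] embed_mult[OF G(2)[of j]]
        by (simp add: action_def proj_add[OF G(1)])
    qed (auto simp: action_def)
  qed
qed

lemma app_act:
  assumes "graded_object K X" "graded_object K Y" "f \<in> GHom K n X Y"
  shows "app (act K n X Y f) = action K n X Y f"
  unfolding act_def using action_add[OF assms] by (simp add: Abs_endo_inverse)

text \<open>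
  Faithfulness is the Yoneda argument: a map is recovered from its values on the identity
  morphisms.
\<close>

lemma act_inject:
  assumes "graded_object K X" "graded_object K Y" "f \<in> GHom K n X Y" "g \<in> GHom K n X Y"
    and "act K n X Y f = act K n X Y g"
  shows "f = g"
proof
  fix i
  define m :: "'o \<Rightarrow> (int \<Rightarrow> 'o) \<Rightarrow> int \<Rightarrow> 'm universal_group"
    where "m = (\<lambda>W Z j. embed (hom_group K W (Z j)) (Ident K W))"
  have "proj (action K n X Y u m (X i) Y (i + n)) (hom_group K (X i) (Y (i + n))) = u i"
    if "u \<in> GHom K n X Y" for u
  proof -
    have "u i \<in> carrier (Hom K (X i) (Y (i + n)))" using that by (simp add: GHom_def)
    then show ?thesis
      using assms(1,2)
      by (simp add: action_def m_def graded_objectD proj_embed hom_comm_group ident_closed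
          comp_ident_right)
  qed
  then show "f i = g i"
    using assms by (metis app_act)
qed

lemma proj_action:
  assumes "graded_object K X" "graded_object K Y" "f \<in> GHom K n X Y" "W \<in> Obj K"
  shows "proj (action K n X Y f m W Y j) (hom_group K W (Y j))
    = Comp K W (X (j - n)) (Y j) (f (j - n))
        (proj (m W X (j - n)) (hom_group K W (X (j - n))))"
  using assms proj_closed[OF hom_comm_group, of W "X (j - n)"] GHom_shift[OF assms(3)]
  by (auto simp: action_def graded_objectD intro!: proj_embed hom_comm_group comp_closed)

lemma act_gcomp:
  assumes X: "graded_object K X" "graded_object K Y" "graded_object K Z"
    and f: "f \<in> GHom K p X Y" and g: "g \<in> GHom K q Y Z" and n: "n = p + q"
  shows "act K n X Z (gcomp K X p Y q Z g f) = act K q Y Z g * act K p X Y f"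
proof (rule endo_eqI)
  fix m
  have gf: "gcomp K X p Y q Z g f \<in> GHom K n X Z" by (intro gcomp_closed assms)
  have "action K n X Z (gcomp K X p Y q Z g f) m W V j
    = action K q Y Z g (action K p X Y f m) W V j" for W V j
  proof (cases "W \<in> Obj K \<and> V = Z")
    case True
    let ?a = "proj (m W X (j - n)) (hom_group K W (X (j - n)))"
    have a: "?a \<in> carrier (Hom K W (X (j - n)))"
      using True X proj_closed[OF hom_comm_group] by (simp add: graded_objectD)
    have "Comp K W (X (j - n)) (Z j) (gcomp K X p Y q Z g f (j - n)) ?a
      = Comp K W (Y (j - q)) (Z j) (g (j - q)) (Comp K W (X (j - n)) (Y (j - q)) (f (j - n)) ?a)"
    proof -
      have [simp]: "j - n + p = j - q" "j - n + p + q = j" using n by auto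
      show ?thesis
        unfolding gcomp_def using True a X f g n
        by (simp, intro comp_assoc[symmetric]) (auto simp: graded_objectD intro!: GHomD)
    qed
    moreover have "X (j - q - p) = X (j - n)" "f (j - q - p) = f (j - n)"
        "m W X (j - q - p) = m W X (j - n)"
      using n by (simp_all add: algebra_simps)
    ultimately show ?thesis
      using True X f by (simp add: action_def[of K n] action_def[of K q] proj_action)
  qed (auto simp: action_def)
  then show "app (act K n X Z (gcomp K X p Y q Z g f)) m
    = app (act K q Y Z g * act K p X Y f) m"
    using assms gf by (simp add: app_act times_endo.rep_eq fun_eq_iff)
qed

lemma act_gadd:
  assumes X: "graded_object K X" "graded_object K Y"
    and f: "f \<in> GHom K n X Y" and g: "g \<in> GHom K n X Y"
  shows "act K n X Y (gadd K n X Y f g) = act K n X Y f + act K n X Y g"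
proof (rule endo_eqI)
  fix m
  have fg: "gadd K n X Y f g \<in> GHom K n X Y" by (intro gadd_closed assms)
  have "action K n X Y (gadd K n X Y f g) m W V j
    = action K n X Y f m W V j + action K n X Y g m W V j" for W V j
  proof (cases "W \<in> Obj K \<and> V = Y")
    case True
    let ?a = "proj (m W X (j - n)) (hom_group K W (X (j - n)))"
    have a: "?a \<in> carrier (Hom K W (X (j - n)))"
      using True X proj_closed[OF hom_comm_group] by (simp add: graded_objectD)
    have u: "f (j - n) \<in> carrier (Hom K (X (j - n)) (Y j))"
        "g (j - n) \<in> carrier (Hom K (X (j - n)) (Y j))"
      using f g by (auto intro!: GHomD)
    have "Comp K W (X (j - n)) (Y j) (gadd K n X Y f g (j - n)) ?a
      = Comp K W (X (j - n)) (Y j) (f (j - n)) ?a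
        \<oplus>\<^bsub>Hom K W (Y j)\<^esub> Comp K W (X (j - n)) (Y j) (g (j - n)) ?a"
      unfolding gadd_def using True a X u by (simp add: comp_add_left graded_objectD)
    then show ?thesis
      using True a u X embed_mult[OF hom_comm_group[of W "Y j"]] comp_closed
      by (simp add: action_def graded_objectD)
  qed (auto simp: action_def)
  then show "app (act K n X Y (gadd K n X Y f g)) m = app (act K n X Y f + act K n X Y g) m"
    using assms fg by (simp add: app_act plus_endo.rep_eq fun_eq_iff)
qed

lemma act_gzero:
  assumes "graded_object K X" "graded_object K Y"
  shows "act K n X Y (gzero K n X Y) = 0"
proof -
  have "gadd K n X Y (gzero K n X Y) (gzero K n X Y) = gzero K n X Y"
    using assms hom_abelian_group
    by (simp add: gadd_def gzero_def fun_eq_iff graded_objectD hom_simps abelian_group.r_neg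
        abelian_groupE(5))
  then show ?thesis
    using act_gadd[OF assms gzero_closed[OF assms] gzero_closed[OF assms], of n] by simp
qed

lemma act_gminus:
  assumes X: "graded_object K X" "graded_object K Y"
    and f: "f \<in> GHom K n X Y" and g: "g \<in> GHom K n X Y"
  shows "act K n X Y (gminus K n X Y f g) = act K n X Y f - act K n X Y g"
proof -
  have "gadd K n X Y (gminus K n X Y f g) g i = f i" for i
  proof -
    interpret H: abelian_group "Hom K (X i) (Y (i + n))"
      using X hom_abelian_group by (simp add: graded_objectD)
    show ?thesis
      using f g by (simp add: gadd_def gminus_def GHom_def a_minus_def H.a_assoc H.l_neg)
  qed
  then have "gadd K n X Y (gminus K n X Y f g) g = f" by auto
  then show ?thesis
    using act_gadd[OF X gminus_closed[OF assms] g] by (simp add: algebra_simps)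
qed

lemma act_gident_left:
  assumes X: "graded_object K X" "graded_object K Y" and f: "f \<in> GHom K n X Y"
  shows "act K 0 Y Y (gident K Y) * act K n X Y f = act K n X Y f"
proof -
  have "gcomp K X n Y 0 Y (gident K Y) f = f"
    using X f by (auto simp: gcomp_def gident_def fun_eq_iff graded_objectD
        intro!: comp_ident_left GHomD)
  then show ?thesis
    using act_gcomp[OF X(1,2,2) f gident_closed[OF X(2)]] by simp
qed

lemma act_gident_right:
  assumes X: "graded_object K X" "graded_object K Y" and f: "f \<in> GHom K n X Y"
  shows "act K n X Y f * act K 0 X X (gident K X) = act K n X Y f"
proof -
  have "gcomp K X 0 X n Y f (gident K X) = f"
    using X f by (auto simp: gcomp_def gident_def fun_eq_iff graded_objectD
        intro!: comp_ident_right GHomD)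
  then show ?thesis
    using act_gcomp[OF X(1,1,2) gident_closed[OF X(1)] f] by simp
qed

end


section \<open>Graded lifts along a functor\<close>

context additive_functor
begin

abbreviation "lifts \<equiv> graded_lifts_map A B F"
abbreviation "ker n X Y \<equiv> carrier (ker_complex A B F X Y n)"

lemma gFObj_graded: "graded_object A X \<Longrightarrow> graded_object B (gFObj F X)"
  by (simp add: graded_object_def gFObj_def obj_closed)

lemma FMap_closed:
  "X \<in> Obj A \<Longrightarrow> Y \<in> Obj A \<Longrightarrow> x \<in> carrier (Hom A X Y)
    \<Longrightarrow> FMap F X Y x \<in> carrier (Hom B (FObj F X) (FObj F Y))"
  using map_additive[of X Y] by (auto simp: hom_def)

lemma FMap_add:
  "X \<in> Obj A \<Longrightarrow> Y \<in> Obj A \<Longrightarrow> x \<in> carrier (Hom A X Y) \<Longrightarrow> y \<in> carrier (Hom A X Y)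
    \<Longrightarrow> FMap F X Y (x \<oplus>\<^bsub>Hom A X Y\<^esub> y) = FMap F X Y x \<oplus>\<^bsub>Hom B (FObj F X) (FObj F Y)\<^esub> FMap F X Y y"
  using map_additive[of X Y] by (auto simp: hom_def)

lemma gFMap_closed:
  "\<lbrakk>graded_object A X; graded_object A Y; x \<in> GHom A n X Y\<rbrakk>
    \<Longrightarrow> gFMap F n X Y x \<in> GHom B n (gFObj F X) (gFObj F Y)"
  by (simp add: GHom_def gFMap_def gFObj_def graded_object_def FMap_closed)

lemma gFMap_gadd:
  "\<lbrakk>graded_object A X; graded_object A Y; x \<in> GHom A n X Y; y \<in> GHom A n X Y\<rbrakk>
    \<Longrightarrow> gFMap F n X Y (gadd A n X Y x y)
      = gadd B n (gFObj F X) (gFObj F Y) (gFMap F n X Y x) (gFMap F n X Y y)"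
  by (simp add: GHom_def gFMap_def gadd_def gFObj_def graded_object_def FMap_add)

lemma gFMap_gident:
  "graded_object A X \<Longrightarrow> gFMap F 0 X X (gident A X) = gident B (gFObj F X)"
  by (simp add: gFMap_def gident_def gFObj_def graded_object_def map_ident)

lemma gFMap_gcomp:
  "\<lbrakk>graded_object A X; graded_object A Y; graded_object A Z;
    x \<in> GHom A p X Y; y \<in> GHom A q Y Z; n = p + q\<rbrakk>
    \<Longrightarrow> gFMap F n X Z (gcomp A X p Y q Z y x)
      = gcomp B (gFObj F X) p (gFObj F Y) q (gFObj F Z) (gFMap F q Y Z y) (gFMap F p X Y x)"
  by (simp add: GHom_def gFMap_def gcomp_def gFObj_def graded_object_def map_comp
      add.assoc[symmetric])

text \<open>
  Equations in the target category are checked on the representing endomorphisms as well.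
\<close>

abbreviation F_act where
  "F_act n X Y x \<equiv> act B n (gFObj F X) (gFObj F Y) (gFMap F n X Y x)"

lemma F_act_gadd:
  "\<lbrakk>graded_object A X; graded_object A Y; x \<in> GHom A n X Y; y \<in> GHom A n X Y\<rbrakk>
    \<Longrightarrow> F_act n X Y (gadd A n X Y x y) = F_act n X Y x + F_act n X Y y"
  by (simp add: gFMap_gadd B.act_gadd gFObj_graded gFMap_closed)

lemma F_act_gcomp:
  "\<lbrakk>graded_object A X; graded_object A Y; graded_object A Z;
    x \<in> GHom A p X Y; y \<in> GHom A q Y Z; n = p + q\<rbrakk>
    \<Longrightarrow> F_act n X Z (gcomp A X p Y q Z y x) = F_act q Y Z y * F_act p X Y x"
  using B.act_gcomp[OF gFObj_graded gFObj_graded gFObj_graded gFMap_closed gFMap_closed]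
  by (simp add: gFMap_gcomp)

lemma F_act_gminus:
  assumes "graded_object A X" "graded_object A Y" "x \<in> GHom A n X Y" "y \<in> GHom A n X Y"
  shows "F_act n X Y (gminus A n X Y x y) = F_act n X Y x - F_act n X Y y"
proof -
  have m: "gminus A n X Y x y \<in> GHom A n X Y" by (intro A.gminus_closed assms)
  have "act A n X Y (gadd A n X Y (gminus A n X Y x y) y) = act A n X Y x"
    using assms m by (simp add: A.act_gadd A.act_gminus)
  then have "gadd A n X Y (gminus A n X Y x y) y = x"
    by (rule A.act_inject[OF assms(1,2) A.gadd_closed[OF assms(1,2) m assms(4)] assms(3)])
  then show ?thesis
    using F_act_gadd[OF assms(1,2) m assms(4)] by (simp add: algebra_simps)
qed

lemma F_act_gzero:
  assumes "graded_object A X" "graded_object A Y"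
  shows "F_act n X Y (gzero A n X Y) = 0"
proof -
  note z = A.gzero_closed[OF assms, of n]
  have "act A n X Y (gminus A n X Y (gzero A n X Y) (gzero A n X Y)) = act A n X Y (gzero A n X Y)"
    using assms z by (simp add: A.act_gminus A.act_gzero)
  then have "gminus A n X Y (gzero A n X Y) (gzero A n X Y) = gzero A n X Y"
    by (rule A.act_inject[OF assms A.gminus_closed[OF assms z z] z])
  then show ?thesis using F_act_gminus[OF assms z z] by simp
qed

lemma ker_iff:
  assumes "graded_object A X" "graded_object A Y"
  shows "x \<in> ker n X Y \<longleftrightarrow> x \<in> GHom A n X Y \<and> F_act n X Y x = 0"
proof -
  have "F_act n X Y x = 0 \<longleftrightarrow> gFMap F n X Y x = gzero B n (gFObj F X) (gFObj F Y)"
    if "x \<in> GHom A n X Y"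
    using B.act_inject[OF gFObj_graded gFObj_graded gFMap_closed B.gzero_closed]
      B.act_gzero[OF gFObj_graded gFObj_graded] assms that gFObj_graded by metis
  then show ?thesis by (auto simp: ker_complex_def)
qed

definition lifted where
  "lifted X Xb c \<longleftrightarrow> graded_object B X \<and> graded_lift_obj A B F X Xb c"

lemma liftedE:
  assumes "lifted X Xb c"
  obtains c1 where "graded_object B X" "graded_object A Xb" "graded_object B (gFObj F Xb)"
    "c \<in> GHom B 0 X (gFObj F Xb)" "c1 \<in> GHom B 0 (gFObj F Xb) X"
    "act B 0 (gFObj F Xb) X c1 * act B 0 X (gFObj F Xb) c = act B 0 X X (gident B X)"
    "act B 0 X (gFObj F Xb) c * act B 0 (gFObj F Xb) X c1
      = act B 0 (gFObj F Xb) (gFObj F Xb) (gident B (gFObj F Xb))"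
proof -
  obtain c1 where *: "graded_object B X" "graded_object A Xb" "graded_object B (gFObj F Xb)"
    "c \<in> GHom B 0 X (gFObj F Xb)" "c1 \<in> GHom B 0 (gFObj F Xb) X"
    "gcomp B X 0 (gFObj F Xb) 0 X c1 c = gident B X"
    "gcomp B (gFObj F Xb) 0 X 0 (gFObj F Xb) c c1 = gident B (gFObj F Xb)"
    using assms by (auto simp: lifted_def graded_lift_obj_def graded_iso_def gFObj_graded)
  show thesis
    by (rule that[OF *(1-5)])
      (use B.act_gcomp[OF *(1,3,1,4,5)] B.act_gcomp[OF *(3,1,3,5,4)] *(6,7) in auto)
qed

text \<open>
  In the representation, a graded lift is an element intertwined with the map below by the
  structure isomorphisms; compatibility of lifts with all operations becomes ring algebra.
\<close>

lemma lifts_iff: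
  assumes "lifted X Xb c" "lifted Y Yb c'" "x \<in> GHom B n X Y"
  shows "xb \<in> lifts X Xb c Y Yb c' n x \<longleftrightarrow>
    xb \<in> GHom A n Xb Yb \<and>
    F_act n Xb Yb xb * act B 0 X (gFObj F Xb) c = act B 0 Y (gFObj F Yb) c' * act B n X Y x"
proof -
  obtain c1 where X: "graded_object B X" "graded_object A Xb" "graded_object B (gFObj F Xb)"
    "c \<in> GHom B 0 X (gFObj F Xb)"
    using assms(1) by (rule liftedE)
  obtain c1 where Y: "graded_object B Y" "graded_object A Yb" "graded_object B (gFObj F Yb)"
    "c' \<in> GHom B 0 Y (gFObj F Yb)"
    using assms(2) by (rule liftedE)
  {
    assume xb: "xb \<in> GHom A n Xb Yb"
    note Fxb = gFMap_closed[OF X(2) Y(2) xb]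
    have 1: "gcomp B X 0 (gFObj F Xb) n (gFObj F Yb) (gFMap F n Xb Yb xb) c
        \<in> GHom B n X (gFObj F Yb)"
      and 2: "gcomp B X n Y 0 (gFObj F Yb) c' x \<in> GHom B n X (gFObj F Yb)"
      using X Y Fxb assms(3) by (auto intro!: B.gcomp_closed)
    have "gcomp B X 0 (gFObj F Xb) n (gFObj F Yb) (gFMap F n Xb Yb xb) c
        = gcomp B X n Y 0 (gFObj F Yb) c' x \<longleftrightarrow>
      F_act n Xb Yb xb * act B 0 X (gFObj F Xb) c = act B 0 Y (gFObj F Yb) c' * act B n X Y x"
      using B.act_inject[OF X(1) Y(3) 1 2]
        B.act_gcomp[OF X(1,3) Y(3) X(4) Fxb, of n] B.act_gcomp[OF X(1) Y(1,3) assms(3) Y(4), of n]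
      by auto
  }
  then show ?thesis by (auto simp: graded_lifts_map_def)
qed

lemma lifts_gcomp:
  assumes "lifted X Xb c" "lifted Y Yb c'" "lifted Z Zb c''"
    and "x \<in> GHom B p X Y" "y \<in> GHom B q Y Z"
    and "xb \<in> lifts X Xb c Y Yb c' p x" "yb \<in> lifts Y Yb c' Z Zb c'' q y" "n = p + q"
  shows "gcomp A Xb p Yb q Zb yb xb \<in> lifts X Xb c Z Zb c'' n (gcomp B X p Y q Z y x)"
proof -
  have gr: "graded_object B X" "graded_object B Y" "graded_object B Z"
    "graded_object A Xb" "graded_object A Yb" "graded_object A Zb"
    using assms by (auto simp: lifted_def graded_lift_obj_def)
  have xb: "xb \<in> GHom A p Xb Yb" "yb \<in> GHom A q Yb Zb"
    "F_act p Xb Yb xb * act B 0 X (gFObj F Xb) c = act B 0 Y (gFObj F Yb) c' * act B p X Y x"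
    "F_act q Yb Zb yb * act B 0 Y (gFObj F Yb) c' = act B 0 Z (gFObj F Zb) c'' * act B q Y Z y"
    using assms by (auto simp: lifts_iff)
  have yx: "gcomp B X p Y q Z y x \<in> GHom B n X Z"
    using assms gr by (auto intro!: B.gcomp_closed)
  have "gcomp A Xb p Yb q Zb yb xb \<in> GHom A n Xb Zb"
    using xb gr assms by (auto intro!: A.gcomp_closed)
  moreover have "F_act q Yb Zb yb * F_act p Xb Yb xb * act B 0 X (gFObj F Xb) c
    = act B 0 Z (gFObj F Zb) c'' * (act B q Y Z y * act B p X Y x)"
    using xb(3,4) by (simp add: mult.assoc) (simp flip: mult.assoc)
  ultimately show ?thesis
    using F_act_gcomp[OF gr(4-6) xb(1,2) assms(8)] B.act_gcomp[OF gr(1-3) assms(4,5,8)]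
    by (simp add: lifts_iff[OF assms(1,3) yx])
qed

lemma lifts_gadd:
  assumes "lifted X Xb c" "lifted Y Yb c'" and x: "x \<in> GHom B n X Y" "y \<in> GHom B n X Y"
    and "xb \<in> lifts X Xb c Y Yb c' n x" "yb \<in> lifts X Xb c Y Yb c' n y"
  shows "gadd A n Xb Yb xb yb \<in> lifts X Xb c Y Yb c' n (gadd B n X Y x y)"
proof -
  have gr: "graded_object B X" "graded_object B Y" "graded_object A Xb" "graded_object A Yb"
    using assms by (auto simp: lifted_def graded_lift_obj_def)
  then show ?thesis
    using assms by (simp add: lifts_iff A.gadd_closed B.gadd_closed F_act_gadd B.act_gadd
        algebra_simps)
qed

lemma lifts_gzero:
  assumes "lifted X Xb c" "lifted Y Yb c'"
  shows "gzero A n Xb Yb \<in> lifts X Xb c Y Yb c' n (gzero B n X Y)"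
proof -
  have gr: "graded_object B X" "graded_object B Y" "graded_object A Xb" "graded_object A Yb"
    using assms by (auto simp: lifted_def graded_lift_obj_def)
  then show ?thesis
    using assms by (simp add: lifts_iff A.gzero_closed B.gzero_closed F_act_gzero B.act_gzero)
qed

lemma lifts_gident:
  assumes "lifted X Xb c"
  shows "gident A Xb \<in> lifts X Xb c X Xb c 0 (gident B X)"
proof -
  obtain c1 where X: "graded_object B X" "graded_object A Xb" "graded_object B (gFObj F Xb)"
    "c \<in> GHom B 0 X (gFObj F Xb)"
    using assms by (rule liftedE)
  show ?thesis
    using assms X B.act_gident_left[OF X(1,3,4)] B.act_gident_right[OF X(1,3,4)]
    by (simp add: lifts_iff A.gident_closed B.gident_closed gFMap_gident)
qed

text \<open>
  The isomorphism \<open>c\<close> can be cancelled, so \<open>F\<close> takes the same value on all lifts of a map.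
\<close>

lemma lifts_unique_mod_ker:
  assumes "lifted X Xb c" "lifted Y Yb c'" "x \<in> GHom B n X Y"
    and "xb \<in> lifts X Xb c Y Yb c' n x" and yb: "yb \<in> GHom A n Xb Yb"
  shows "yb \<in> lifts X Xb c Y Yb c' n x \<longleftrightarrow> gminus A n Xb Yb yb xb \<in> ker n Xb Yb"
proof -
  obtain c1 where X: "graded_object A Xb" "graded_object B (gFObj F Xb)"
    "act B 0 X (gFObj F Xb) c * act B 0 (gFObj F Xb) X c1
      = act B 0 (gFObj F Xb) (gFObj F Xb) (gident B (gFObj F Xb))"
    using assms(1) by (rule liftedE)
  have Y: "graded_object A Yb" using assms(2) by (simp add: lifted_def graded_lift_obj_def)
  let ?c = "act B 0 X (gFObj F Xb) c"
  have xb: "xb \<in> GHom A n Xb Yb"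
    and eq: "F_act n Xb Yb xb * ?c = act B 0 Y (gFObj F Yb) c' * act B n X Y x"
    using assms by (auto simp: lifts_iff)
  have cancel: "F_act n Xb Yb z * ?c * act B 0 (gFObj F Xb) X c1 = F_act n Xb Yb z"
    if "z \<in> GHom A n Xb Yb" for z
    using B.act_gident_right[OF X(2) gFObj_graded[OF Y] gFMap_closed[OF X(1) Y that]] X(3)
    by (simp add: mult.assoc)
  have "yb \<in> lifts X Xb c Y Yb c' n x \<longleftrightarrow> F_act n Xb Yb yb * ?c = F_act n Xb Yb xb * ?c"
    using assms eq by (simp add: lifts_iff)
  also have "\<dots> \<longleftrightarrow> F_act n Xb Yb yb = F_act n Xb Yb xb"
    using cancel[OF xb] cancel[OF yb] by auto
  also have "\<dots> \<longleftrightarrow> gminus A n Xb Yb yb xb \<in> ker n Xb Yb"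
    using X(1) Y xb yb by (simp add: ker_iff A.gminus_closed F_act_gminus)
  finally show ?thesis .
qed

text \<open>
  Fullness lifts the conjugate \<open>c' x c\<^sup>-\<^sup>1\<close> degree by degree.
\<close>

lemma lift_exists:
  assumes full: "full_functor A B F" and "lifted X Xb c" "lifted Y Yb c'" "x \<in> GHom B n X Y"
  obtains xb where "xb \<in> lifts X Xb c Y Yb c' n x"
proof -
  obtain c1 where X: "graded_object B X" "graded_object A Xb" "graded_object B (gFObj F Xb)"
    "c \<in> GHom B 0 X (gFObj F Xb)" "c1 \<in> GHom B 0 (gFObj F Xb) X"
    "act B 0 (gFObj F Xb) X c1 * act B 0 X (gFObj F Xb) c = act B 0 X X (gident B X)"
    using assms(2) by (rule liftedE)
  obtain c2 where Y: "graded_object B Y" "graded_object A Yb" "graded_object B (gFObj F Yb)"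
    "c' \<in> GHom B 0 Y (gFObj F Yb)"
    using assms(3) by (rule liftedE)
  define u where "u = gcomp B (gFObj F Xb) n Y 0 (gFObj F Yb) c' (gcomp B (gFObj F Xb) 0 X n Y x c1)"
  have xc: "gcomp B (gFObj F Xb) 0 X n Y x c1 \<in> GHom B n (gFObj F Xb) Y"
    using X Y assms(4) by (auto intro!: B.gcomp_closed)
  have u: "u \<in> GHom B n (gFObj F Xb) (gFObj F Yb)"
    unfolding u_def using X Y xc by (auto intro!: B.gcomp_closed)
  have "\<exists>a. a \<in> carrier (Hom A (Xb i) (Yb (i + n))) \<and> FMap F (Xb i) (Yb (i + n)) a = u i" for i
  proof -
    have "u i \<in> FMap F (Xb i) (Yb (i + n)) ` carrier (Hom A (Xb i) (Yb (i + n)))"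
      using full u X(2) Y(2) by (auto simp: full_functor_def GHom_def gFObj_def graded_object_def)
    then show ?thesis by auto
  qed
  then obtain xb where "\<And>i. xb i \<in> carrier (Hom A (Xb i) (Yb (i + n)))"
      "\<And>i. FMap F (Xb i) (Yb (i + n)) (xb i) = u i"
    by metis
  then have xb: "xb \<in> GHom A n Xb Yb" and Fxb: "gFMap F n Xb Yb xb = u"
    by (auto simp: GHom_def gFMap_def)
  have "act B n (gFObj F Xb) (gFObj F Yb) u
    = act B 0 Y (gFObj F Yb) c' * (act B n X Y x * act B 0 (gFObj F Xb) X c1)"
    using B.act_gcomp[OF X(3) Y(1,3) xc Y(4), of n] B.act_gcomp[OF X(3,1) Y(1) X(5) assms(4), of n]
    by (simp add: u_def)
  then have "F_act n Xb Yb xb * act B 0 X (gFObj F Xb) c = act B 0 Y (gFObj F Yb) c' * act B n X Y x"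
    using X(6) B.act_gident_right[OF X(1) Y(1) assms(4)] by (simp add: Fxb mult.assoc)
  then show thesis using that xb assms by (simp add: lifts_iff)
qed

text \<open>
  The lift \<open>x0\<close> chosen in the definition of the class differs from the cochain map \<open>xb\<close> by some
  \<open>z\<close> in the kernel complex, and \<open>\<delta> xb = 0\<close>, so the class is represented by the coboundary
  \<open>\<delta> z\<close>. Its coset is the subgroup of coboundaries itself, which is the unit of the quotient.
\<close>

lemma obstruction_eq_one:
  assumes X: "lifted X Xb c" "lifted Y Yb c'" and x: "x \<in> GHom B 0 X Y"
    and d: "d \<in> GHom A 1 Xb Xb" "d' \<in> GHom A 1 Yb Yb"
    and xb: "xb \<in> L_map A B F X Xb c Y Yb c' x d d'"
  shows "obstruction A B F X Xb c Y Yb c' x d d' = \<one>\<^bsub>obstruction_group A B F Xb Yb d d'\<^esub>"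
proof -
  have gr: "graded_object A Xb" "graded_object A Yb"
    using X by (auto simp: lifted_def graded_lift_obj_def)
  let ?\<delta> = "delta A Xb d Yb d' 0"
  let ?H = "?\<delta> ` ker 0 Xb Yb"
  define x0 where "x0 = (SOME fb. fb \<in> lifts X Xb c Y Yb c' 0 x)"
  have xb_lift: "xb \<in> lifts X Xb c Y Yb c' 0 x" using xb by (simp add: L_map_def)
  then have x0_lift: "x0 \<in> lifts X Xb c Y Yb c' 0 x" unfolding x0_def by (rule someI[of "\<lambda>fb. fb \<in> lifts X Xb c Y Yb c' 0 x"])
  have x0: "x0 \<in> GHom A 0 Xb Yb" and xb': "xb \<in> GHom A 0 Xb Yb"
    using x0_lift xb_lift X x by (auto simp: lifts_iff)
  define D where "D = (\<lambda>u. act A 1 Yb Yb d' * u - u * act A 1 Xb Xb d)"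
  have delta: "?\<delta> z \<in> GHom A 1 Xb Yb" "act A 1 Xb Yb (?\<delta> z) = D (act A 0 Xb Yb z)"
    if "z \<in> GHom A 0 Xb Yb" for z
    using that gr d by (auto simp: delta_def D_def A.gminus_closed A.gcomp_closed A.act_gminus
        A.act_gcomp)
  have "act A 1 Yb Yb d' * act A 0 Xb Yb xb = act A 0 Xb Yb xb * act A 1 Xb Xb d"
    using xb xb' gr d A.act_gcomp[of Xb Yb Yb xb 0 d' 1 1] A.act_gcomp[of Xb Xb Yb d 1 xb 0 1]
    by (simp add: L_map_def cochain_map_def)
  then have "D (act A 0 Xb Yb xb) = 0" by (simp add: D_def)
  define z where "z = gminus A 0 Xb Yb x0 xb"
  have z: "z \<in> ker 0 Xb Yb"
    unfolding z_def using lifts_unique_mod_ker[OF X x xb_lift x0] x0_lift by simp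
  have ker_sub: "y \<in> GHom A 0 Xb Yb" if "y \<in> ker 0 Xb Yb" for y
    using that gr by (simp add: ker_iff)
  have ker_diff: "gadd A 0 Xb Yb y y' \<in> ker 0 Xb Yb" "gminus A 0 Xb Yb y y' \<in> ker 0 Xb Yb"
    if "y \<in> ker 0 Xb Yb" "y' \<in> ker 0 Xb Yb" for y y'
    using that gr by (simp_all add: ker_iff A.gadd_closed A.gminus_closed F_act_gadd F_act_gminus)
  have D_simps: "D (u + v) = D u + D v" "D (u - v) = D u - D v" for u v
    by (simp_all add: D_def algebra_simps)
  have eqI: "a = b" if "a \<in> GHom A 1 Xb Yb" "b \<in> GHom A 1 Xb Yb" "act A 1 Xb Yb a = act A 1 Xb Yb b"
    for a b using A.act_inject[OF gr] that .
  have "?\<delta> x0 = ?\<delta> z"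
    by (rule eqI) (use \<open>D (act A 0 Xb Yb xb) = 0\<close> x0 xb' z ker_sub gr in
        \<open>simp_all add: delta z_def A.act_gminus D_simps\<close>)
  have sum: "gadd A 1 Xb Yb (?\<delta> y) (?\<delta> y') = ?\<delta> (gadd A 0 Xb Yb y y')"
    if "y \<in> ker 0 Xb Yb" "y' \<in> ker 0 Xb Yb" for y y'
    by (rule eqI) (use that[THEN ker_sub] gr in
        \<open>simp_all add: delta A.act_gadd A.gadd_closed D_simps\<close>)
  have "?H = (\<lambda>a. gadd A 1 Xb Yb a (?\<delta> z)) ` ?H"
  proof (intro equalityI subsetI)
    fix a assume "a \<in> ?H"
    then obtain y where y: "y \<in> ker 0 Xb Yb" "a = ?\<delta> y" by auto
    have "gadd A 0 Xb Yb (gminus A 0 Xb Yb y z) z = y"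
      by (rule A.act_inject[OF gr, where n = 0]) (use y z ker_sub gr in
        \<open>simp_all add: A.act_gadd A.act_gminus A.gadd_closed A.gminus_closed\<close>)
    then have "a = gadd A 1 Xb Yb (?\<delta> (gminus A 0 Xb Yb y z)) (?\<delta> z)"
      using sum[OF ker_diff(2)[OF y(1) z] z] y by simp
    then show "a \<in> (\<lambda>a. gadd A 1 Xb Yb a (?\<delta> z)) ` ?H"
      using ker_diff(2)[OF y(1) z] by auto
  next
    fix a assume "a \<in> (\<lambda>a. gadd A 1 Xb Yb a (?\<delta> z)) ` ?H"
    then obtain y where "y \<in> ker 0 Xb Yb" "a = gadd A 1 Xb Yb (?\<delta> y) (?\<delta> z)" by auto
    then show "a \<in> ?H" using sum[of y z] ker_diff(1)[of y z] z by blast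
  qed
  moreover have "obstruction A B F X Xb c Y Yb c' x d d'
    = (\<lambda>a. gadd A 1 Xb Yb a (?\<delta> x0)) ` ?H"
    by (auto simp: obstruction_def cohomology_class_def coboundaries_def r_coset_def
        cocycle_group_def ker_complex_def x0_def)
  moreover have "\<one>\<^bsub>obstruction_group A B F Xb Yb d d'\<^esub> = ?H"
    by (simp add: obstruction_group_def cohomology_def FactGroup_def coboundaries_def)
  ultimately show ?thesis using \<open>?\<delta> x0 = ?\<delta> z\<close> by simp
qed


section \<open>Lifting homotopy equivalences\<close>

definition act_hom where
  "act_hom n X Y = {act A n X Y x | x. x \<in> GHom A n X Y \<and> graded_object A X \<and> graded_object A Y}"

definition act_ker where
  "act_ker n X Y = {act A n X Y x | x. x \<in> ker n X Y \<and> graded_object A X \<and> graded_object A Y}"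

abbreviation "act_ident X \<equiv> act A 0 X X (gident A X)"

lemma act_homE:
  assumes "a \<in> act_hom n X Y"
  obtains x where "a = act A n X Y x" "x \<in> GHom A n X Y" "graded_object A X" "graded_object A Y"
  using assms by (auto simp: act_hom_def)

lemma act_kerE:
  assumes "a \<in> act_ker n X Y"
  obtains x where "a = act A n X Y x" "x \<in> GHom A n X Y" "F_act n X Y x = 0"
    "graded_object A X" "graded_object A Y"
  using assms by (auto simp: act_ker_def ker_iff)

lemma act_homI:
  "x \<in> GHom A n X Y \<Longrightarrow> graded_object A X \<Longrightarrow> graded_object A Y \<Longrightarrow> act A n X Y x \<in> act_hom n X Y"
  by (auto simp: act_hom_def)

lemma act_kerI:
  "x \<in> GHom A n X Y \<Longrightarrow> F_act n X Y x = 0 \<Longrightarrow> graded_object A X \<Longrightarrow> graded_object A Y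
    \<Longrightarrow> act A n X Y x \<in> act_ker n X Y"
  by (auto simp: act_ker_def ker_iff)

lemma ker_gcomp:
  assumes "Ker_square_zero A B F" and gr: "graded_object A X" "graded_object A Y" "graded_object A Z"
    and x: "x \<in> GHom A p X Y" "F_act p X Y x = 0" and y: "y \<in> GHom A q Y Z" "F_act q Y Z y = 0"
  shows "gcomp A X p Y q Z y x = gzero A (p + q) X Z"
proof
  fix i
  have "x \<in> ker p X Y" "y \<in> ker q Y Z" using x y gr by (auto simp: ker_iff)
  then have "gFMap F p X Y x i = gzero B p (gFObj F X) (gFObj F Y) i"
    "gFMap F q Y Z y (i + p) = gzero B q (gFObj F Y) (gFObj F Z) (i + p)"
    by (auto simp: ker_complex_def)
  then have "x i \<in> Ker A B F (X i) (Y (i + p))"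
    "y (i + p) \<in> Ker A B F (Y (i + p)) (Z (i + p + q))"
    using x y by (auto simp: Ker_def gFMap_def gzero_def gFObj_def GHom_def)
  then show "gcomp A X p Y q Z y x i = gzero A (p + q) X Z i"
    using assms(1) gr by (auto simp: Ker_square_zero_def gcomp_def gzero_def graded_object_def
        add.assoc)
qed

lemma graded_square_zero_act:
  assumes "Ker_square_zero A B F"
  shows "graded_square_zero act_hom act_ker act_ident"
proof
  fix a b n X Y
  show "a + b \<in> act_hom n X Y" if "a \<in> act_hom n X Y" "b \<in> act_hom n X Y"
    using that by (auto elim!: act_homE intro!: act_homI A.gadd_closed simp flip: A.act_gadd)
  have uminus: "- act A n X Y x = act A n X Y (gminus A n X Y (gzero A n X Y) x)"
    if "x \<in> GHom A n X Y" "graded_object A X" "graded_object A Y" for x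
    using that by (simp add: A.act_gminus A.act_gzero A.gzero_closed)
  show "- a \<in> act_hom n X Y" if "a \<in> act_hom n X Y"
    using that by (auto elim!: act_homE intro!: act_homI A.gminus_closed A.gzero_closed
        simp: uminus)
  show "act_ident Y * a = a" "a * act_ident X = a" if "a \<in> act_hom n X Y"
    using that by (auto elim!: act_homE simp: A.act_gident_left A.act_gident_right)
  show "a \<in> act_hom n X Y" if "a \<in> act_ker n X Y"
    using that by (auto elim!: act_kerE intro!: act_homI)
  show "a + b \<in> act_ker n X Y" if "a \<in> act_ker n X Y" "b \<in> act_ker n X Y"
    using that by (auto elim!: act_kerE intro!: act_kerI A.gadd_closed
        simp: F_act_gadd simp flip: A.act_gadd)
  show "- a \<in> act_ker n X Y" if "a \<in> act_ker n X Y"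
    using that by (auto elim!: act_kerE intro!: act_kerI A.gminus_closed A.gzero_closed
        simp: uminus F_act_gminus F_act_gzero A.gzero_closed)
next
  fix a b n p q X Y Z
  show "b * a \<in> act_hom n X Z" if "a \<in> act_hom p X Y" "b \<in> act_hom q Y Z" "n = p + q"
    using that by (auto elim!: act_homE intro!: act_homI A.gcomp_closed simp flip: A.act_gcomp)
  show "b * a \<in> act_ker n X Z" if "a \<in> act_ker p X Y" "b \<in> act_hom q Y Z" "n = p + q"
    using that by (auto elim!: act_homE act_kerE intro!: act_kerI A.gcomp_closed
        simp: F_act_gcomp simp flip: A.act_gcomp)
  show "b * a \<in> act_ker n X Z" if "a \<in> act_hom p X Y" "b \<in> act_ker q Y Z" "n = p + q"
    using that by (auto elim!: act_homE act_kerE intro!: act_kerI A.gcomp_closed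
        simp: F_act_gcomp simp flip: A.act_gcomp)
  show "b * a = 0" if "a \<in> act_ker p X Y" "b \<in> act_ker q Y Z"
    using that ker_gcomp[OF assms]
    by (auto elim!: act_kerE simp: A.act_gzero simp flip: A.act_gcomp)
qed

lemma act_diff_ker:
  assumes "lifted X Xb c" "lifted Y Yb c'" "x \<in> GHom B n X Y"
    and "xb \<in> lifts X Xb c Y Yb c' n x" "yb \<in> lifts X Xb c Y Yb c' n x"
  shows "act A n Xb Yb xb - act A n Xb Yb yb \<in> act_ker n Xb Yb"
proof -
  have gr: "graded_object A Xb" "graded_object A Yb"
    using assms by (auto simp: lifted_def graded_lift_obj_def)
  have G: "xb \<in> GHom A n Xb Yb" "yb \<in> GHom A n Xb Yb" using assms by (auto simp: lifts_iff)
  then have "gminus A n Xb Yb xb yb \<in> ker n Xb Yb"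
    using lifts_unique_mod_ker assms by blast
  then show ?thesis
    unfolding A.act_gminus[OF gr G, symmetric] using gr by (auto simp: act_ker_def)
qed

text \<open>
  Corrections by the ideal, made inside the ring, come back as graded lifts of the same map.
\<close>

lemma lift_of_act:
  assumes "lifted X Xb c" "lifted Y Yb c'" "x \<in> GHom B n X Y"
    and "xb \<in> lifts X Xb c Y Yb c' n x"
    and "u \<in> act_hom n Xb Yb" "u - act A n Xb Yb xb \<in> act_ker n Xb Yb"
  obtains yb where "yb \<in> lifts X Xb c Y Yb c' n x" "yb \<in> GHom A n Xb Yb" "u = act A n Xb Yb yb"
proof -
  obtain yb where yb: "u = act A n Xb Yb yb" "yb \<in> GHom A n Xb Yb"
    and gr: "graded_object A Xb" "graded_object A Yb"
    using assms(5) by (rule act_homE)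
  have xb: "xb \<in> GHom A n Xb Yb" using assms by (auto simp: lifts_iff)
  obtain z where z: "u - act A n Xb Yb xb = act A n Xb Yb z" "z \<in> GHom A n Xb Yb"
    "F_act n Xb Yb z = 0"
    using assms(6) by (rule act_kerE)
  have "gminus A n Xb Yb yb xb = z"
    by (rule A.act_inject[OF gr A.gminus_closed[OF gr yb(2) xb] z(2)])
      (simp add: A.act_gminus gr yb(2) xb flip: yb(1) z(1))
  then have "gminus A n Xb Yb yb xb \<in> ker n Xb Yb" using z gr by (simp add: ker_iff)
  then show thesis
    using that yb lifts_unique_mod_ker[OF assms(1-4) yb(2)] by blast
qed

lemma homotopicE:
  assumes "linear_category K" "homotopic K X dX X dX u (gident K X)" "u \<in> GHom K 0 X X"
    and X: "graded_object K X" and d: "dX \<in> GHom K 1 X X"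
  obtains h where "h \<in> GHom K (- 1) X X"
    "u = gadd K 0 X X (gident K X)
      (gadd K 0 X X (gcomp K X (- 1) X 1 X dX h) (gcomp K X 1 X (- 1) X h dX))"
proof -
  interpret K: linear_category K by fact
  obtain h where h: "h \<in> GHom K (- 1) X X"
    and eq: "gminus K 0 X X u (gident K X) = delta K X dX X dX (- 1) h"
    using assms by (auto simp: homotopic_def)
  let ?dh = "gadd K 0 X X (gcomp K X (- 1) X 1 X dX h) (gcomp K X 1 X (- 1) X h dX)"
  have dh: "?dh \<in> GHom K 0 X X"
    using X h d by (auto intro!: K.gadd_closed K.gcomp_closed)
  have "act K 0 X X u - act K 0 X X (gident K X) = act K 0 X X ?dh"
    using eq K.act_gminus[OF X X assms(3) K.gident_closed[OF X]] by (simp add: delta_def)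
  then have "act K 0 X X u = act K 0 X X (gadd K 0 X X (gident K X) ?dh)"
    by (simp add: K.act_gadd[OF X X K.gident_closed[OF X] dh] algebra_simps)
  then have "u = gadd K 0 X X (gident K X) ?dh"
    by (rule K.act_inject[OF X X assms(3) K.gadd_closed[OF X X K.gident_closed[OF X] dh]])
  then show thesis using that h by blast
qed

lemma homotopicI:
  assumes "linear_category K"
    and X: "graded_object K X" and d: "dX \<in> GHom K 1 X X"
    and u: "u \<in> GHom K 0 X X" and h: "h \<in> GHom K (- 1) X X"
    and eq: "act K 0 X X u - act K 0 X X (gident K X)
      = act K 1 X X dX * act K (- 1) X X h + act K (- 1) X X h * act K 1 X X dX"
  shows "homotopic K X dX X dX u (gident K X)"
proof -
  interpret K: linear_category K by fact
  let ?dh = "gadd K 0 X X (gcomp K X (- 1) X 1 X dX h) (gcomp K X 1 X (- 1) X h dX)"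
  have *: "gcomp K X (- 1) X 1 X dX h \<in> GHom K 0 X X" "gcomp K X 1 X (- 1) X h dX \<in> GHom K 0 X X"
    using X h d by (auto intro!: K.gcomp_closed)
  have "act K 0 X X (gminus K 0 X X u (gident K X)) = act K 0 X X ?dh"
    using eq X h d u * by (simp add: K.act_gminus K.gident_closed K.act_gadd K.act_gcomp)
  then have "gminus K 0 X X u (gident K X) = ?dh"
    by (rule K.act_inject[OF X X K.gminus_closed[OF X X u K.gident_closed[OF X]]
          K.gadd_closed[OF X X *]])
  then show ?thesis using h by (auto simp: homotopic_def delta_def)
qed

text \<open>
  Both sides of each relation that holds for \<open>f\<close>, \<open>g\<close>, the differentials and the homotopies have
  canonical lifts built from the chosen lifts. As two lifts of one map differ by an element of
  the kernel, each relation persists modulo the kernel.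
\<close>

lemma equivalence_mod_ker:
  assumes sq: "Ker_square_zero A B F" and full: "full_functor A B F"
    and X: "lifted X Xb c" and Y: "lifted Y Yb c'"
    and dX: "dX \<in> GHom B 1 X X" and dY: "dY \<in> GHom B 1 Y Y"
    and inverse: "homotopy_inverse B X dX Y dY f g"
    and lifts: "dXb \<in> lifts X Xb c X Xb c 1 dX" "dYb \<in> lifts Y Yb c' Y Yb c' 1 dY"
      "fb \<in> lifts X Xb c Y Yb c' 0 f" "gb \<in> lifts Y Yb c' X Xb c 0 g"
  obtains h k where "equivalence_mod_ideal act_hom act_ker act_ident Xb Yb
    (act A 1 Xb Xb dXb) (act A 1 Yb Yb dYb) (act A 0 Xb Yb fb) (act A 0 Yb Xb gb) h k"
proof -
  have gr: "graded_object B X" "graded_object B Y" "graded_object A Xb" "graded_object A Yb"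
    using X Y by (auto simp: lifted_def graded_lift_obj_def)
  have f: "f \<in> GHom B 0 X Y" and g: "g \<in> GHom B 0 Y X"
    and f_chain: "gcomp B X 0 Y 1 Y dY f = gcomp B X 1 X 0 Y f dX"
    and g_chain: "gcomp B Y 0 X 1 X dX g = gcomp B Y 1 Y 0 X g dY"
    and gf: "homotopic B X dX X dX (gcomp B X 0 Y 0 X g f) (gident B X)"
    and fg: "homotopic B Y dY Y dY (gcomp B Y 0 X 0 Y f g) (gident B Y)"
    using inverse by (auto simp: homotopy_inverse_def cochain_map_def)
  have B_lin: "linear_category B" by unfold_locales
  have gf': "gcomp B X 0 Y 0 X g f \<in> GHom B 0 X X" and fg': "gcomp B Y 0 X 0 Y f g \<in> GHom B 0 Y Y"
    using f g gr by (auto intro!: B.gcomp_closed)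
  obtain h where h: "h \<in> GHom B (- 1) X X"
    and gf_eq: "gcomp B X 0 Y 0 X g f = gadd B 0 X X (gident B X)
      (gadd B 0 X X (gcomp B X (- 1) X 1 X dX h) (gcomp B X 1 X (- 1) X h dX))"
    using homotopicE[OF B_lin gf gf' gr(1) dX] .
  obtain k where k: "k \<in> GHom B (- 1) Y Y"
    and fg_eq: "gcomp B Y 0 X 0 Y f g = gadd B 0 Y Y (gident B Y)
      (gadd B 0 Y Y (gcomp B Y (- 1) Y 1 Y dY k) (gcomp B Y 1 Y (- 1) Y k dY))"
    using homotopicE[OF B_lin fg fg' gr(2) dY] .
  obtain hb where hb: "hb \<in> lifts X Xb c X Xb c (- 1) h" using lift_exists[OF full X X h] .
  obtain kb where kb: "kb \<in> lifts Y Yb c' Y Yb c' (- 1) k" using lift_exists[OF full Y Y k] .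
  have G: "dXb \<in> GHom A 1 Xb Xb" "dYb \<in> GHom A 1 Yb Yb" "fb \<in> GHom A 0 Xb Yb"
    "gb \<in> GHom A 0 Yb Xb" "hb \<in> GHom A (- 1) Xb Xb" "kb \<in> GHom A (- 1) Yb Yb"
    using lifts hb kb by (auto simp: graded_lifts_map_def)
  interpret graded_square_zero act_hom act_ker act_ident
    using sq by (rule graded_square_zero_act)
  have homotopy_lift: "act A 0 Zb Zb u - (act_ident Zb + (act A 1 Zb Zb dZb * act A (- 1) Zb Zb sb
        + act A (- 1) Zb Zb sb * act A 1 Zb Zb dZb)) \<in> act_ker 0 Zb Zb"
    if Z: "lifted Z Zb e" and d: "dZ \<in> GHom B 1 Z Z" "dZb \<in> lifts Z Zb e Z Zb e 1 dZ"
      and s: "s \<in> GHom B (- 1) Z Z" "sb \<in> lifts Z Zb e Z Zb e (- 1) s"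
      and u: "u \<in> lifts Z Zb e Z Zb e 0 (gadd B 0 Z Z (gident B Z)
        (gadd B 0 Z Z (gcomp B Z (- 1) Z 1 Z dZ s) (gcomp B Z 1 Z (- 1) Z s dZ)))"
    for Z Zb e dZ dZb s sb u
  proof -
    have grZ: "graded_object B Z" "graded_object A Zb"
      using Z by (auto simp: lifted_def graded_lift_obj_def)
    have GZ: "dZb \<in> GHom A 1 Zb Zb" "sb \<in> GHom A (- 1) Zb Zb"
      using d s by (auto simp: graded_lifts_map_def)
    let ?r = "\<lambda>K Z dZ s. gadd K 0 Z Z (gident K Z)
        (gadd K 0 Z Z (gcomp K Z (- 1) Z 1 Z dZ s) (gcomp K Z 1 Z (- 1) Z s dZ))"
    have 1: "gcomp B Z (- 1) Z 1 Z dZ s \<in> GHom B 0 Z Z" "gcomp B Z 1 Z (- 1) Z s dZ \<in> GHom B 0 Z Z"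
      using grZ d s by (auto intro!: B.gcomp_closed)
    have 2: "gcomp A Zb (- 1) Zb 1 Zb dZb sb \<in> GHom A 0 Zb Zb"
        "gcomp A Zb 1 Zb (- 1) Zb sb dZb \<in> GHom A 0 Zb Zb"
      using grZ GZ by (auto intro!: A.gcomp_closed)
    have "?r A Zb dZb sb \<in> lifts Z Zb e Z Zb e 0 (?r B Z dZ s)"
      using grZ 1
      by (intro lifts_gadd[OF Z Z] B.gident_closed B.gadd_closed lifts_gident[OF Z]
          lifts_gcomp[OF Z Z Z s(1) d(1) s(2) d(2)] lifts_gcomp[OF Z Z Z d(1) s(1) d(2) s(2)]) auto
    moreover have "?r B Z dZ s \<in> GHom B 0 Z Z"
      using grZ 1 by (intro B.gident_closed B.gadd_closed)
    ultimately have "act A 0 Zb Zb u - act A 0 Zb Zb (?r A Zb dZb sb) \<in> act_ker 0 Zb Zb"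
      using act_diff_ker[OF Z Z _ u] by blast
    then show ?thesis
      using grZ GZ 2 by (simp add: A.act_gadd A.act_gcomp A.gadd_closed A.gident_closed)
  qed
  have chain_lift: "act A 1 Vb Vb dVb * act A 0 Ub Vb ub - act A 0 Ub Vb ub * act A 1 Ub Ub dUb
      \<in> act_ker 1 Ub Vb"
    if U: "lifted U Ub e" and V: "lifted V Vb e'"
      and d: "dU \<in> GHom B 1 U U" "dUb \<in> lifts U Ub e U Ub e 1 dU"
        "dV \<in> GHom B 1 V V" "dVb \<in> lifts V Vb e' V Vb e' 1 dV"
      and u: "u \<in> GHom B 0 U V" "ub \<in> lifts U Ub e V Vb e' 0 u"
      and chain: "gcomp B U 0 V 1 V dV u = gcomp B U 1 U 0 V u dU"
    for U Ub e V Vb e' dU dUb dV dVb u ub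
  proof -
    have grU: "graded_object B U" "graded_object A Ub" "graded_object B V" "graded_object A Vb"
      using U V by (auto simp: lifted_def graded_lift_obj_def)
    have GU: "dUb \<in> GHom A 1 Ub Ub" "dVb \<in> GHom A 1 Vb Vb" "ub \<in> GHom A 0 Ub Vb"
      using d u by (auto simp: graded_lifts_map_def)
    have "gcomp A Ub 0 Vb 1 Vb dVb ub \<in> lifts U Ub e V Vb e' 1 (gcomp B U 0 V 1 V dV u)"
      using lifts_gcomp[OF U V V u(1) d(3) u(2) d(4)] by simp
    moreover have "gcomp A Ub 1 Ub 0 Vb ub dUb \<in> lifts U Ub e V Vb e' 1 (gcomp B U 0 V 1 V dV u)"
      using lifts_gcomp[OF U U V d(1) u(1) d(2) u(2)] chain by simp
    moreover have "gcomp B U 0 V 1 V dV u \<in> GHom B 1 U V"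
      using grU d u by (auto intro!: B.gcomp_closed)
    ultimately have "act A 1 Ub Vb (gcomp A Ub 0 Vb 1 Vb dVb ub)
        - act A 1 Ub Vb (gcomp A Ub 1 Ub 0 Vb ub dUb) \<in> act_ker 1 Ub Vb"
      using act_diff_ker[OF U V] by blast
    then show ?thesis using grU GU by (simp add: A.act_gcomp)
  qed
  have "gcomp A Xb 0 Yb 0 Xb gb fb \<in> lifts X Xb c X Xb c 0 (gcomp B X 0 Y 0 X g f)"
    "gcomp A Yb 0 Xb 0 Yb fb gb \<in> lifts Y Yb c' Y Yb c' 0 (gcomp B Y 0 X 0 Y f g)"
    using lifts_gcomp[OF X Y X f g] lifts_gcomp[OF Y X Y g f] lifts by auto
  note * = homotopy_lift[OF X dX lifts(1) h hb this(1)[unfolded gf_eq]]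
    homotopy_lift[OF Y dY lifts(2) k kb this(2)[unfolded fg_eq]]
    chain_lift[OF X Y dX lifts(1) dY lifts(2) f lifts(3) f_chain]
    chain_lift[OF Y X dY lifts(2) dX lifts(1) g lifts(4) g_chain]
  have "equivalence_mod_ideal act_hom act_ker act_ident Xb Yb
    (act A 1 Xb Xb dXb) (act A 1 Yb Yb dYb) (act A 0 Xb Yb fb) (act A 0 Yb Xb gb)
    (act A (- 1) Xb Xb hb) (act A (- 1) Yb Yb kb)"
    using * G gr by unfold_locales (auto intro!: act_homI simp: A.act_gcomp)
  then show thesis by (rule that)
qed

lemma lift_differential_along_equivalence:
  assumes sq: "Ker_square_zero A B F" and full: "full_functor A B F"
    and X: "lifted X Xb c" and Y: "lifted Y Yb c'"
    and cX: "cochain_complex B X dX" and cY: "cochain_complex B Y dY"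
    and inverse: "homotopy_inverse B X dX Y dY f g"
    and dYb: "dYb \<in> L_diff A B F Y Yb c' dY"
  obtains dXb fb where "dXb \<in> L_diff A B F X Xb c dX" "fb \<in> L_map A B F X Xb c Y Yb c' f dXb dYb"
proof -
  have gr: "graded_object A Xb" "graded_object A Yb" "graded_object B X"
    using X Y by (auto simp: lifted_def graded_lift_obj_def)
  have dX: "dX \<in> GHom B 1 X X" "gcomp B X 1 X 1 X dX dX = gzero B 2 X X"
    and dY: "dY \<in> GHom B 1 Y Y"
    using cX cY by (auto simp: cochain_complex_def)
  have f: "f \<in> GHom B 0 X Y" and g: "g \<in> GHom B 0 Y X"
    using inverse by (auto simp: homotopy_inverse_def cochain_map_def)
  obtain d where d: "d \<in> lifts X Xb c X Xb c 1 dX" using lift_exists[OF full X X dX(1)] .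
  obtain f0 where f0: "f0 \<in> lifts X Xb c Y Yb c' 0 f" using lift_exists[OF full X Y f] .
  obtain g0 where g0: "g0 \<in> lifts Y Yb c' X Xb c 0 g" using lift_exists[OF full Y X g] .
  have dYb': "dYb \<in> lifts Y Yb c' Y Yb c' 1 dY" "gcomp A Yb 1 Yb 1 Yb dYb dYb = gzero A 2 Yb Yb"
    using dYb by (auto simp: L_diff_def)
  have G: "d \<in> GHom A 1 Xb Xb" "dYb \<in> GHom A 1 Yb Yb"
    using d dYb' by (auto simp: graded_lifts_map_def)
  obtain h k where "equivalence_mod_ideal act_hom act_ker act_ident Xb Yb
    (act A 1 Xb Xb d) (act A 1 Yb Yb dYb) (act A 0 Xb Yb f0) (act A 0 Yb Xb g0) h k"
    using equivalence_mod_ker[OF sq full X Y dX(1) dY inverse d dYb'(1) f0 g0] .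
  then interpret E: equivalence_mod_ideal act_hom act_ker act_ident Xb Yb
    "act A 1 Xb Xb d" "act A 1 Yb Yb dYb" "act A 0 Xb Yb f0" "act A 0 Yb Xb g0" h k .
  have "act A 1 Yb Yb dYb * act A 1 Yb Yb dYb = 0"
    using A.act_gcomp[OF gr(2,2,2) G(2,2), of 2] dYb'(2) gr by (simp add: A.act_gzero)
  moreover have "act A 1 Xb Xb d * act A 1 Xb Xb d \<in> act_ker 2 Xb Xb"
  proof -
    have "gcomp A Xb 1 Xb 1 Xb d d \<in> lifts X Xb c X Xb c 2 (gzero B 2 X X)"
      using lifts_gcomp[OF X X X dX(1,1) d d, of 2] dX(2) by simp
    then show ?thesis
      using act_diff_ker[OF X X B.gzero_closed[OF gr(3,3)] _ lifts_gzero[OF X X]]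
        A.act_gcomp[OF gr(1,1,1) G(1,1), of 2] gr by (fastforce simp: A.act_gzero)
  qed
  ultimately obtain d2 f2 where "d2 \<in> act_hom 1 Xb Xb" "f2 \<in> act_hom 0 Xb Yb"
    "d2 - act A 1 Xb Xb d \<in> act_ker 1 Xb Xb" "f2 - act A 0 Xb Yb f0 \<in> act_ker 0 Xb Yb"
    and eq: "d2 * d2 = 0" "act A 1 Yb Yb dYb * f2 = f2 * d2"
    by (rule E.lift_differential)
  then obtain dXb fb where dXb: "dXb \<in> lifts X Xb c X Xb c 1 dX" "dXb \<in> GHom A 1 Xb Xb"
      "d2 = act A 1 Xb Xb dXb"
    and fb: "fb \<in> lifts X Xb c Y Yb c' 0 f" "fb \<in> GHom A 0 Xb Yb" "f2 = act A 0 Xb Yb fb"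
    using lift_of_act[OF X X dX(1) d] lift_of_act[OF X Y f f0] by metis
  have "gcomp A Xb 1 Xb 1 Xb dXb dXb = gzero A 2 Xb Xb"
    by (rule A.act_inject[OF gr(1,1) A.gcomp_closed A.gzero_closed])
      (use gr dXb eq in \<open>auto simp: A.act_gcomp A.act_gzero\<close>)
  moreover have "gcomp A Xb 0 Yb 1 Yb dYb fb = gcomp A Xb 1 Xb 0 Yb fb dXb"
    by (rule A.act_inject[where n = 1, OF gr(1,2) A.gcomp_closed A.gcomp_closed])
      (use gr dXb fb eq G in \<open>auto simp: A.act_gcomp\<close>)
  ultimately show thesis
    using that[of dXb fb] dXb fb by (auto simp: L_diff_def L_map_def cochain_map_def)
qed

lemma lift_homotopy_inverse_of_chain_map:
  assumes sq: "Ker_square_zero A B F" and full: "full_functor A B F"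
    and X: "lifted X Xb c" and Y: "lifted Y Yb c'"
    and cX: "cochain_complex B X dX" and cY: "cochain_complex B Y dY"
    and inverse: "homotopy_inverse B X dX Y dY f g"
    and dXb: "dXb \<in> L_diff A B F X Xb c dX" and dYb: "dYb \<in> L_diff A B F Y Yb c' dY"
    and fb: "fb \<in> L_map A B F X Xb c Y Yb c' f dXb dYb"
  obtains gb where "gb \<in> L_map A B F Y Yb c' X Xb c g dYb dXb"
    "homotopy_inverse A Xb dXb Yb dYb fb gb"
proof -
  have gr: "graded_object A Xb" "graded_object A Yb"
    using X Y by (auto simp: lifted_def graded_lift_obj_def)
  have dX: "dX \<in> GHom B 1 X X" and dY: "dY \<in> GHom B 1 Y Y"
    using cX cY by (auto simp: cochain_complex_def)
  have g: "g \<in> GHom B 0 Y X"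
    using inverse by (auto simp: homotopy_inverse_def cochain_map_def)
  obtain g0 where g0: "g0 \<in> lifts Y Yb c' X Xb c 0 g" using lift_exists[OF full Y X g] .
  have lifts: "dXb \<in> lifts X Xb c X Xb c 1 dX" "dYb \<in> lifts Y Yb c' Y Yb c' 1 dY"
      "fb \<in> lifts X Xb c Y Yb c' 0 f"
    and eqs: "gcomp A Xb 1 Xb 1 Xb dXb dXb = gzero A 2 Xb Xb"
      "gcomp A Yb 1 Yb 1 Yb dYb dYb = gzero A 2 Yb Yb"
      "gcomp A Xb 0 Yb 1 Yb dYb fb = gcomp A Xb 1 Xb 0 Yb fb dXb"
    using dXb dYb fb by (auto simp: L_diff_def L_map_def cochain_map_def)
  have G: "dXb \<in> GHom A 1 Xb Xb" "dYb \<in> GHom A 1 Yb Yb" "fb \<in> GHom A 0 Xb Yb"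
    using lifts by (auto simp: graded_lifts_map_def)
  obtain h k where "equivalence_mod_ideal act_hom act_ker act_ident Xb Yb
    (act A 1 Xb Xb dXb) (act A 1 Yb Yb dYb) (act A 0 Xb Yb fb) (act A 0 Yb Xb g0) h k"
    using equivalence_mod_ker[OF sq full X Y dX dY inverse lifts g0] .
  then interpret E: equivalence_mod_ideal act_hom act_ker act_ident Xb Yb
    "act A 1 Xb Xb dXb" "act A 1 Yb Yb dYb" "act A 0 Xb Yb fb" "act A 0 Yb Xb g0" h k .
  have "act A 1 Xb Xb dXb * act A 1 Xb Xb dXb = 0" "act A 1 Yb Yb dYb * act A 1 Yb Yb dYb = 0"
    "act A 1 Yb Yb dYb * act A 0 Xb Yb fb = act A 0 Xb Yb fb * act A 1 Xb Xb dXb"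
    using A.act_gcomp[OF gr(1,1,1) G(1,1), of 2] A.act_gcomp[OF gr(2,2,2) G(2,2), of 2]
      A.act_gcomp[OF gr(1,2,2) G(3,2), of 1] A.act_gcomp[OF gr(1,1,2) G(1,3), of 1] eqs gr
    by (simp_all add: A.act_gzero)
  then obtain g' a b where "g' \<in> act_hom 0 Yb Xb" "g' - act A 0 Yb Xb g0 \<in> act_ker 0 Yb Xb"
    and ab: "a \<in> act_hom (- 1) Xb Xb" "b \<in> act_hom (- 1) Yb Yb"
    and eq: "act A 1 Xb Xb dXb * g' = g' * act A 1 Yb Yb dYb"
      "g' * act A 0 Xb Yb fb - act_ident Xb = act A 1 Xb Xb dXb * a + a * act A 1 Xb Xb dXb"
      "act A 0 Xb Yb fb * g' - act_ident Yb = act A 1 Yb Yb dYb * b + b * act A 1 Yb Yb dYb"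
    by (rule E.lift_homotopy_inverse)
  then obtain gb where gb: "gb \<in> lifts Y Yb c' X Xb c 0 g" "gb \<in> GHom A 0 Yb Xb"
    "g' = act A 0 Yb Xb gb"
    using lift_of_act[OF Y X g g0] by metis
  obtain ha where ha: "a = act A (- 1) Xb Xb ha" "ha \<in> GHom A (- 1) Xb Xb"
    using ab(1) by (rule act_homE)
  obtain hb where hb: "b = act A (- 1) Yb Yb hb" "hb \<in> GHom A (- 1) Yb Yb"
    using ab(2) by (rule act_homE)
  have "gcomp A Yb 0 Xb 1 Xb dXb gb = gcomp A Yb 1 Yb 0 Xb gb dYb"
    by (rule A.act_inject[where n = 1, OF gr(2,1) A.gcomp_closed A.gcomp_closed])
      (use gr gb eq G in \<open>auto simp: A.act_gcomp\<close>)
  then have chain: "cochain_map A Yb dYb Xb dXb gb" using gb by (simp add: cochain_map_def)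
  have A_lin: "linear_category A" by unfold_locales
  have "homotopic A Xb dXb Xb dXb (gcomp A Xb 0 Yb 0 Xb gb fb) (gident A Xb)"
    by (rule homotopicI[OF A_lin gr(1) G(1) A.gcomp_closed ha(2)])
      (use gr gb G eq ha in \<open>auto simp: A.act_gcomp\<close>)
  moreover have "homotopic A Yb dYb Yb dYb (gcomp A Yb 0 Xb 0 Yb fb gb) (gident A Yb)"
    by (rule homotopicI[OF A_lin gr(2) G(2) A.gcomp_closed hb(2)])
      (use gr gb G eq hb in \<open>auto simp: A.act_gcomp\<close>)
  moreover have "cochain_map A Xb dXb Yb dYb fb" using fb by (simp add: L_map_def)
  ultimately show thesis
    using that[of gb] gb chain by (simp add: L_map_def homotopy_inverse_def)
qed

end

theorem corollary3p11:
  fixes Kb :: "('r, 'o, 'm) lin_cat"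
    and K :: "('s, 'p, 'n) lin_cat"
    and F :: "('o, 'm, 'p, 'n) lin_functor"
    and C D :: "int \<Rightarrow> 'p" and dC dD f g :: "int \<Rightarrow> 'n"
    and Cb Db :: "int \<Rightarrow> 'o" and c c' :: "int \<Rightarrow> 'n"
  assumes "linear_category Kb" and "linear_category K"
    and "additive_functor Kb K F"
    and "full_functor Kb K F"
    and "Ker_square_zero Kb K F"
    and "cochain_complex K C dC" and "cochain_complex K D dD"
    and "cochain_map K C dC D dD f" and "cochain_map K D dD C dC g"
    and "homotopy_inverse K C dC D dD f g"
    and "graded_lift_obj Kb K F C Cb c"
    and "graded_lift_obj Kb K F D Db c'"
  shows "(\<forall>dDb \<in> L_diff Kb K F D Db c' dD.
            \<exists>dCb \<in> L_diff Kb K F C Cb c dC.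
              obstruction Kb K F C Cb c D Db c' f dCb dDb
              = \<one>\<^bsub>obstruction_group Kb K F Cb Db dCb dDb\<^esub>)
       \<and> (\<forall>dDb \<in> L_diff Kb K F D Db c' dD. \<forall>dCb \<in> L_diff Kb K F C Cb c dC.
            \<forall>fb \<in> L_map Kb K F C Cb c D Db c' f dCb dDb.
              (\<exists>gb \<in> L_map Kb K F D Db c' C Cb c g dDb dCb.
                 homotopy_inverse Kb Cb dCb Db dDb fb gb)
              \<and> homotopy_equivalence Kb Cb dCb Db dDb fb)"
proof -
  interpret additive_functor Kb K F by fact
  have C: "lifted C Cb c" and D: "lifted D Db c'"
    using assms by (auto simp: lifted_def cochain_complex_def)
  note data = assms(5,4) C D assms(6,7,10)
  show ?thesis
  proof (intro conjI ballI)
    fix dDb assume dDb: "dDb \<in> L_diff Kb K F D Db c' dD"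
    obtain dCb fb where dCb: "dCb \<in> L_diff Kb K F C Cb c dC"
      and fb: "fb \<in> L_map Kb K F C Cb c D Db c' f dCb dDb"
      using lift_differential_along_equivalence[OF data dDb] .
    have "obstruction Kb K F C Cb c D Db c' f dCb dDb
        = \<one>\<^bsub>obstruction_group Kb K F Cb Db dCb dDb\<^esub>"
      using assms(8) dCb dDb
      by (intro obstruction_eq_one[OF C D _ _ _ fb])
        (auto simp: cochain_map_def L_diff_def graded_lifts_map_def)
    then show "\<exists>dCb \<in> L_diff Kb K F C Cb c dC.
        obstruction Kb K F C Cb c D Db c' f dCb dDb
        = \<one>\<^bsub>obstruction_group Kb K F Cb Db dCb dDb\<^esub>"
      using dCb by blast
  next
    fix dDb dCb fb
    assume "dDb \<in> L_diff Kb K F D Db c' dD" "dCb \<in> L_diff Kb K F C Cb c dC"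
      "fb \<in> L_map Kb K F C Cb c D Db c' f dCb dDb"
    then obtain gb where "gb \<in> L_map Kb K F D Db c' C Cb c g dDb dCb"
      "homotopy_inverse Kb Cb dCb Db dDb fb gb"
      using lift_homotopy_inverse_of_chain_map[OF data] by blast
    then show "\<exists>gb \<in> L_map Kb K F D Db c' C Cb c g dDb dCb.
        homotopy_inverse Kb Cb dCb Db dDb fb gb"
      and "homotopy_equivalence Kb Cb dCb Db dDb fb"
      by (auto simp: homotopy_equivalence_def)
  qed
qed

end
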